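(* For every integer $q>1$ there exist constants $C_0,C_1,\dots,C_{q-2}$, depending only on $q$, such that the following holds. Let $N:(0,\infty)\to\mathbb{R}$ be a nondecreasing function such that $N(\lambda)=0$ for all sufficiently small $\lambda>0$ and $\int_0^\infty\lambda^{-q}\,dN(\lambda)<\infty$. Let $\zeta_0=\lambda_0+i\eta_0$ with $\lambda_0>0$, $\eta_0>0$, and suppose that $N$ is constant in a neighbourhood of $\lambda_0$. Let $\Gamma$ be a contour in $\mathbb{C}$ connecting $\overline{\zeta_0}=\lambda_0-i\eta_0$ to $\zeta_0$, oriented from $\overline{\zeta_0}$ to $\zeta_0$, which does not cross $\mathbb{R}_+=(0,+\infty)$. Then $$\left|N(\lambda_0)-\frac{1}{2\pi i}\int_\Gamma S_q(\zeta)(\lambda_0-\zeta)^{q-1}\,d\zeta\right|\le\sum_{m=0}^{q-2}C_m\,\eta_0^{\,q-1-m}\left|\int_\Gamma S_q(\zeta)(\lambda_0-\zeta)^m\,d\zeta\right|.$$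
   Context: Integrals with respect to $dN$ are Stieltjes integrals. The generalized Stieltjes transform of $N$ is $$S_q(\zeta)=\int_0^\infty(\lambda-\zeta)^{-q}\,dN(\lambda),\qquad \zeta\in\mathbb{C}\setminus\mathbb{R}_+ .$$ A contour means a piecewise smooth path; "does not cross $\mathbb{R}_+$" means it lies in $\mathbb{C}\setminus\mathbb{R}_+$. *)

theory Defs
  imports "HOL-Complex_Analysis.Complex_Analysis"
begin

(* The library's interval_measure is meaningful only for right-continuous functions on the whole
   real line, whereas N is an arbitrary nondecreasing function on (0, \<infinity>).  Passing to the
   right-continuous modification gives the usual Lebesgue-Stieltjes measure of N, for which the
   interval (a, b] has mass N(b+) - N(a+); see emeasure_stieltjes_Ioc.  Values of N on (-\<infinity>, 0]
   are irrelevant. *)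
definition right_limit :: "(real \<Rightarrow> real) \<Rightarrow> real \<Rightarrow> real" where
  "right_limit N x = (if 0 < x then Lim (at_right x) N else 0)"

definition stieltjes :: "(real \<Rightarrow> real) \<Rightarrow> real measure" where
  "stieltjes N = interval_measure (right_limit N)"

definition stieltjes_transform :: "nat \<Rightarrow> (real \<Rightarrow> real) \<Rightarrow> complex \<Rightarrow> complex" where
  "stieltjes_transform q N \<zeta> =
     (LINT x:{0<..}|stieltjes N. 1 / (complex_of_real x - \<zeta>) ^ q)"

lemma right_limit_eq_INF:
  assumes "mono_on {0<..} N" "0 < x"
  shows "right_limit N x = (INF y\<in>{x<..}. N y)"
    and "(N \<longlongrightarrow> (INF y\<in>{x<..}. N y)) (at_right x)"
    and "\<And>y. x < y \<Longrightarrow> (INF y\<in>{x<..}. N y) \<le> N y"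
    and "N x \<le> (INF y\<in>{x<..}. N y)"
proof -
  have mono: "N y \<le> N z" if "x \<le> y" "y \<le> z" for y z
    using assms that by (auto intro: mono_onD)
  have bdd: "bdd_below (N ` {x<..})"
    by (rule bdd_belowI2[of _ "N x"]) (use mono in auto)
  show low: "(INF y\<in>{x<..}. N y) \<le> N y" if "x < y" for y
    using bdd that by (auto intro: cINF_lower)
  show up: "N x \<le> (INF y\<in>{x<..}. N y)"
    by (rule cINF_greatest) (use mono in auto)
  show lim: "(N \<longlongrightarrow> (INF y\<in>{x<..}. N y)) (at_right x)"
  proof (rule order_tendstoI)
    fix a assume a: "a < (INF y\<in>{x<..}. N y)"
    show "\<forall>\<^sub>F y in at_right x. a < N y"
      unfolding eventually_at_right_field
      by (rule exI[of _ "x + 1"]) (use a low in \<open>auto intro: less_le_trans\<close>)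
  next
    fix a assume "(INF y\<in>{x<..}. N y) < a"
    then obtain z where z: "x < z" "N z < a"
      using bdd by (subst (asm) cINF_less_iff) auto
    have "N y < a" if "x < y" "y < z" for y
      using mono[of y z] z(2) that by simp
    with z(1) show "\<forall>\<^sub>F y in at_right x. N y < a"
      unfolding eventually_at_right_field by auto
  qed
  show "right_limit N x = (INF y\<in>{x<..}. N y)"
    using lim assms(2) by (simp add: right_limit_def tendsto_Lim)
qed

lemma right_limit_zero:
  assumes "mono_on {0<..} N" "\<forall>\<^sub>F x in at_right 0. N x = 0"
  shows "\<exists>\<delta>>0. \<forall>x<\<delta>. right_limit N x = 0"
proof -
  obtain d where d: "0 < d" "\<And>y. 0 < y \<Longrightarrow> y < d \<Longrightarrow> N y = 0"
    using assms(2) unfolding eventually_at_right_field by auto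
  have "right_limit N x = 0" if "x < d" for x
  proof (cases "0 < x")
    case True
    have "((\<lambda>_. 0) \<longlongrightarrow> 0) (at_right x)" by simp
    moreover have "\<forall>\<^sub>F y in at_right x. 0 = N y"
      unfolding eventually_at_right_field
      by (rule exI[of _ d]) (use that True d in auto)
    ultimately have "(N \<longlongrightarrow> 0) (at_right x)"
      by (rule Lim_transform_eventually)
    with True show ?thesis by (simp add: right_limit_def tendsto_Lim)
  qed (simp add: right_limit_def)
  with d show ?thesis by blast
qed

lemma right_limit_mono:
  assumes "mono_on {0<..} N" "\<forall>\<^sub>F x in at_right 0. N x = 0" "x \<le> y"
  shows "right_limit N x \<le> right_limit N y"
proof -
  note R = right_limit_eq_INF[OF assms(1)]
  have pos: "right_limit N x \<le> right_limit N y" if "0 < x" "x \<le> y" for x y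
  proof (cases "x = y")
    case False
    then have "right_limit N x \<le> N y" using R(1,3)[of x] that by simp
    also have "\<dots> \<le> right_limit N y" using R(1,4)[of y] that by simp
    finally show ?thesis .
  qed simp
  obtain d where d: "0 < d" "\<And>x. x < d \<Longrightarrow> right_limit N x = 0"
    using right_limit_zero[OF assms(1,2)] by blast
  show ?thesis
  proof (cases "0 < x")
    case False
    then have x0: "right_limit N x = 0" using d by simp
    show ?thesis
    proof (cases "y < d")
      case False
      then show ?thesis using pos[of "d/2" y] d(1) d(2)[of "d/2"] x0 by simp
    qed (use d x0 in simp)
  qed (use pos assms(3) in auto)
qed

lemma right_limit_continuous:
  assumes "mono_on {0<..} N" "\<forall>\<^sub>F x in at_right 0. N x = 0"
  shows "continuous (at_right x) (right_limit N)"
proof (cases "0 < x")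
  case True
  note R = right_limit_eq_INF[OF assms(1)]
  have "(right_limit N \<longlongrightarrow> right_limit N x) (at_right x)"
  proof (rule order_tendstoI)
    fix a assume a: "a < right_limit N x"
    show "\<forall>\<^sub>F y in at_right x. a < right_limit N y"
      unfolding eventually_at_right_field
      by (rule exI[of _ "x + 1"])
         (use a right_limit_mono[OF assms, of x] in \<open>auto intro: less_le_trans\<close>)
  next
    fix a assume "right_limit N x < a"
    then have "\<forall>\<^sub>F y in at_right x. N y < a"
      using R(1,2)[OF True] by (simp add: order_tendsto_iff)
    then obtain b where b: "x < b" "\<And>y. x < y \<Longrightarrow> y < b \<Longrightarrow> N y < a"
      unfolding eventually_at_right_field by auto
    have "right_limit N y < a" if "x < y" "y < b" for y
    proof -
      have "right_limit N y \<le> N ((y + b) / 2)"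
        using R(1,3)[of y] that True by simp
      also have "\<dots> < a" using b(2) that by simp
      finally show ?thesis .
    qed
    with b(1) show "\<forall>\<^sub>F y in at_right x. right_limit N y < a"
      unfolding eventually_at_right_field by auto
  qed
  then show ?thesis by (simp add: continuous_within)
next
  case False
  obtain d where d: "0 < d" "\<And>x. x < d \<Longrightarrow> right_limit N x = 0"
    using right_limit_zero[OF assms] by blast
  have "((\<lambda>_. 0) \<longlongrightarrow> right_limit N x) (at_right x)"
    using False d by simp
  moreover have "\<forall>\<^sub>F y in at_right x. 0 = right_limit N y"
    unfolding eventually_at_right_field
    by (rule exI[of _ d]) (use False d in auto)
  ultimately show ?thesis
    unfolding continuous_within by (rule Lim_transform_eventually)
qed

lemma emeasure_stieltjes_Ioc:
  assumes "mono_on {0<..} N" "\<forall>\<^sub>F x in at_right 0. N x = 0" "a \<le> b"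
  shows "emeasure (stieltjes N) {a<..b} = ennreal (right_limit N b - right_limit N a)"
  unfolding stieltjes_def
  using assms(3) right_limit_mono[OF assms(1,2)] right_limit_continuous[OF assms(1,2)]
  by (rule emeasure_interval_measure_Ioc)

end

theory Submission
  imports Defs
begin

text \<open>Put \<open>w = \<zeta> - \<lambda>\<^sub>0\<close>. Exchanging the integrals turns both sides into integrals over \<open>dN(\<lambda>)\<close> of the
  kernels \<open>F\<^sub>m(\<lambda>) = \<integral> (\<lambda>\<^sub>0 - \<zeta>)\<^sup>m (\<lambda> - \<zeta>)\<^bsup>-q\<^esup> d\<zeta>\<close>, which depend only on the endpoints of \<open>\<Gamma>\<close>, because \<open>\<Gamma>\<close> lies
  in a simply connected slit plane.  Let \<open>\<rho> = \<bar>\<lambda> - \<zeta>\<^sub>0\<bar>\<close>.  Two pointwise facts then suffice.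

  First, \<open>F\<^bsub>q-1\<^esub> + \<kappa> \<eta>\<^sub>0\<^sup>2 F\<^bsub>q-3\<^esub>\<close> with \<open>\<kappa> = (q - 2)/q\<close> has, up to a constant, the numerator
  \<open>d/dw (w\<^bsup>q-2\<^esup> (\<eta>\<^sub>0\<^sup>2 + w\<^sup>2))\<close>.  Integrating by parts and moving the contour to the half circle around \<open>\<lambda>\<^sub>0\<close>
  on the far side from \<open>\<lambda>\<close> shows that it equals \<open>2\<pi>i\<close> times the indicator of \<open>\<lambda> < \<lambda>\<^sub>0\<close> up to
  \<open>2\<pi> (\<eta>\<^sub>0/\<rho>)\<^bsup>q+1\<^esup>\<close>.

  Second, this error is dominated by a positive combination: the numerator \<open>(\<eta>\<^sub>0\<^sup>2 + w\<^sup>2)\<^bsup>(q-2)/2\<^esup>\<close> for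
  even \<open>q\<close>, or \<open>w (\<eta>\<^sub>0\<^sup>2 + w\<^sup>2)\<^bsup>(q-3)/2\<^esup>\<close> for odd \<open>q\<close>, gives a combination of \<open>F\<^sub>0, \<dots>, F\<^bsub>q-2\<^esub>\<close> which is
  \<open>i\<close> times a positive constant times \<open>(\<eta>\<^sub>0/\<rho>)\<^sup>q\<close> or \<open>(\<eta>\<^sub>0/\<rho>)\<^bsup>q+1\<^esup>\<close>, by a Moebius substitution.  As
  \<open>dN\<close> is positive, the integral of the error is bounded by the integral of this combination.\<close>

lemma has_field_derivative_integral:
  fixes f f' :: "'a \<Rightarrow> complex \<Rightarrow> complex"
  assumes "0 < r"
    and deriv: "\<And>x z. x \<in> space M \<Longrightarrow> z \<in> cball z\<^sub>0 r \<Longrightarrow> (f x has_field_derivative f' x z) (at z)"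
    and int: "\<And>z. z \<in> cball z\<^sub>0 r \<Longrightarrow> integrable M (\<lambda>x. f x z)"
    and g: "integrable M g" "\<And>x z. x \<in> space M \<Longrightarrow> z \<in> cball z\<^sub>0 r \<Longrightarrow> norm (f' x z) \<le> g x"
  shows "((\<lambda>z. \<integral>x. f x z \<partial>M) has_field_derivative (\<integral>x. f' x z\<^sub>0 \<partial>M)) (at z\<^sub>0)"
proof -
  define D where "D z x = (f x z - f x z\<^sub>0) / (z - z\<^sub>0)" for z x
  have z0: "z\<^sub>0 \<in> cball z\<^sub>0 r" using \<open>0 < r\<close> by simp
  have lim: "((\<lambda>z. D z x) \<longlongrightarrow> f' x z\<^sub>0) (at z\<^sub>0)" if "x \<in> space M" for x
    using deriv[OF that z0] unfolding D_def has_field_derivative_iff .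
  have near: "\<forall>\<^sub>F z in at z\<^sub>0. z \<in> cball z\<^sub>0 r \<and> z \<noteq> z\<^sub>0"
    unfolding eventually_at by (rule exI[of _ r]) (use \<open>0 < r\<close> in \<open>auto simp: dist_commute\<close>)
  have bound: "norm (D z x) \<le> g x" if "x \<in> space M" "z \<in> cball z\<^sub>0 r" "z \<noteq> z\<^sub>0" for x z
  proof -
    have "norm (f x z - f x z\<^sub>0) \<le> g x * norm (z - z\<^sub>0)"
      by (rule field_differentiable_bound[where f' = "f' x" and S = "cball z\<^sub>0 r"])
        (use that deriv g z0 in \<open>auto intro: DERIV_subset\<close>)
    then show ?thesis
      using that(3) by (simp add: D_def norm_divide divide_simps)
  qed
  have "((\<lambda>z. \<integral>x. D z x \<partial>M) \<longlongrightarrow> (\<integral>x. f' x z\<^sub>0 \<partial>M)) (at z\<^sub>0)"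
    unfolding tendsto_at_iff_sequentially comp_def
  proof (intro allI impI)
    fix X :: "nat \<Rightarrow> complex"
    assume X: "\<forall>i. X i \<in> UNIV - {z\<^sub>0}" "X \<longlonglongrightarrow> z\<^sub>0"
    have "\<forall>\<^sub>F n in sequentially. X n \<in> cball z\<^sub>0 r"
      using tendstoD[OF X(2) \<open>0 < r\<close>] by eventually_elim (auto simp: dist_commute)
    then obtain k where k: "\<And>n. X (n + k) \<in> cball z\<^sub>0 r"
      unfolding eventually_sequentially by (metis le_add2)
    have X0: "X n \<noteq> z\<^sub>0" for n using X(1) by auto
    have lim': "(\<lambda>n. D (X (n + k)) x) \<longlonglongrightarrow> f' x z\<^sub>0" if "x \<in> space M" for x
      using lim[OF that] LIMSEQ_ignore_initial_segment[OF X(2), of k] X0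
      unfolding tendsto_at_iff_sequentially comp_def by auto
    have meas: "D (X (n + k)) \<in> borel_measurable M" for n
      unfolding D_def using int[OF k[of n]] int[OF z0] by auto
    have "(\<lambda>n. \<integral>x. D (X (n + k)) x \<partial>M) \<longlonglongrightarrow> (\<integral>x. f' x z\<^sub>0 \<partial>M)"
    proof (rule integral_dominated_convergence[OF _ meas g(1)])
      show "(\<lambda>x. f' x z\<^sub>0) \<in> borel_measurable M"
        by (rule borel_measurable_LIMSEQ_metric[OF meas]) (rule lim')
    qed (use lim' bound k X0 in auto)
    then show "(\<lambda>n. \<integral>x. D (X n) x \<partial>M) \<longlonglongrightarrow> (\<integral>x. f' x z\<^sub>0 \<partial>M)"
      by (rule LIMSEQ_offset)
  qed
  moreover have "\<forall>\<^sub>F z in at z\<^sub>0. (\<integral>x. D z x \<partial>M) =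
      ((\<integral>x. f x z \<partial>M) - (\<integral>x. f x z\<^sub>0 \<partial>M)) / (z - z\<^sub>0)"
    using near
  proof eventually_elim
    case (elim z)
    then show ?case
      using int[of z] int[OF z0] unfolding D_def by simp
  qed
  ultimately show ?thesis
    unfolding has_field_derivative_iff by (rule Lim_transform_eventually)
qed

text \<open>Fubini's theorem is not available here, since a \<^const>\<open>valid_path\<close> need not be rectifiable.  Integrating
  primitives of the integrand instead avoids it.\<close>
lemma contour_integral_of_integral:
  fixes f f' :: "'a \<Rightarrow> complex \<Rightarrow> complex"
  assumes U: "open U" "b \<in> U" "\<And>z. z \<in> U \<Longrightarrow> closed_segment b z \<subseteq> U"
    and deriv: "\<And>x z. x \<in> space M \<Longrightarrow> z \<in> U \<Longrightarrow> (f x has_field_derivative f' x z) (at z)"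
    and meas: "\<And>z. z \<in> U \<Longrightarrow> (\<lambda>x. f x z) \<in> borel_measurable M"
    and dom: "\<And>K. compact K \<Longrightarrow> K \<subseteq> U \<Longrightarrow>
      \<exists>g. integrable M g \<and> (\<forall>x\<in>space M. \<forall>z\<in>K. norm (f' x z) \<le> g x)"
    and \<gamma>: "valid_path \<gamma>" "path_image \<gamma> \<subseteq> U"
  shows "integrable M (\<lambda>x. f x (pathfinish \<gamma>) - f x (pathstart \<gamma>))"
    and "((\<lambda>z. \<integral>x. f' x z \<partial>M) has_contour_integral
            (\<integral>x. f x (pathfinish \<gamma>) - f x (pathstart \<gamma>) \<partial>M)) \<gamma>"
proof -
  define h where "h x z = f x z - f x b" for x z
  have int: "integrable M (\<lambda>x. h x z)" if z: "z \<in> U" for z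
  proof -
    obtain g where g: "integrable M g" "\<And>x w. x \<in> space M \<Longrightarrow> w \<in> closed_segment b z \<Longrightarrow> norm (f' x w) \<le> g x"
      using dom[OF compact_segment U(3)[OF z]] by blast
    show ?thesis
    proof (rule Bochner_Integration.integrable_bound)
      show "integrable M (\<lambda>x. g x * norm (z - b))" using g(1) by simp
      show "(\<lambda>x. h x z) \<in> borel_measurable M"
        unfolding h_def using meas U(2) z by simp
      have "norm (h x z) \<le> g x * norm (z - b)" if x: "x \<in> space M" for x
        unfolding h_def
        by (rule field_differentiable_bound[where f' = "f' x" and S = "closed_segment b z"])
          (use x U(3)[OF z] deriv g(2) in \<open>auto intro: DERIV_subset[OF deriv]\<close>)
      then show "AE x in M. norm (h x z) \<le> norm (g x * norm (z - b))"
        by (intro AE_I2) fastforce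
    qed
  qed
  have D: "((\<lambda>z. \<integral>x. h x z \<partial>M) has_field_derivative (\<integral>x. f' x z \<partial>M)) (at z within U)"
    if z: "z \<in> U" for z
  proof -
    obtain r where r: "0 < r" "cball z r \<subseteq> U"
      using U(1) z open_contains_cball by blast
    obtain g where "integrable M g" "\<And>x w. x \<in> space M \<Longrightarrow> w \<in> cball z r \<Longrightarrow> norm (f' x w) \<le> g x"
      using dom[OF compact_cball r(2)] by blast
    then have "((\<lambda>z. \<integral>x. h x z \<partial>M) has_field_derivative (\<integral>x. f' x z \<partial>M)) (at z)"
      by (intro has_field_derivative_integral[OF r(1)])
        (use r int in \<open>auto simp: h_def intro!: derivative_eq_intros deriv\<close>)
    then show ?thesis by (rule DERIV_subset) simp
  qed
  have ends: "pathstart \<gamma> \<in> U" "pathfinish \<gamma> \<in> U"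
    using \<gamma>(2) by (auto simp: subset_iff)
  note H = int[OF ends(2)] int[OF ends(1)]
  have eq: "(\<lambda>x. f x (pathfinish \<gamma>) - f x (pathstart \<gamma>)) = (\<lambda>x. h x (pathfinish \<gamma>) - h x (pathstart \<gamma>))"
    by (simp add: h_def)
  show "integrable M (\<lambda>x. f x (pathfinish \<gamma>) - f x (pathstart \<gamma>))"
    unfolding eq using H by simp
  show "((\<lambda>z. \<integral>x. f' x z \<partial>M) has_contour_integral
            (\<integral>x. f x (pathfinish \<gamma>) - f x (pathstart \<gamma>) \<partial>M)) \<gamma>"
    unfolding eq using contour_integral_primitive[OF D \<gamma>] H by simp
qed

text \<open>A primitive in \<open>z\<close> of \<open>(a - z)\<^sup>m / (x - z)\<^sup>q\<close>, obtained by expanding in powers of \<open>x - z\<close>; \<open>L\<close> is a branch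
  of the logarithm.\<close>
definition kernel_primitive :: "(complex \<Rightarrow> complex) \<Rightarrow> nat \<Rightarrow> nat \<Rightarrow> complex \<Rightarrow> complex \<Rightarrow> complex \<Rightarrow> complex" where
  "kernel_primitive L q m a x z = (\<Sum>j\<le>m. of_nat (m choose j) * (a - x) ^ (m - j) *
     (if Suc j = q then - L (x - z) else 1 / (of_nat (q - 1 - j) * (x - z) ^ (q - 1 - j))))"

lemma kernel_primitive_deriv:
  assumes "m < q" "x \<noteq> z"
    and L: "Suc m = q \<Longrightarrow> (L has_field_derivative 1 / (x - z)) (at (x - z))"
  shows "(kernel_primitive L q m a x has_field_derivative (a - z) ^ m / (x - z) ^ q) (at z)"
proof -
  have D: "((\<lambda>z. if Suc j = q then - L (x - z) else 1 / (of_nat (q - 1 - j) * (x - z) ^ (q - 1 - j)))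
      has_field_derivative (x - z) ^ j / (x - z) ^ q) (at z)" if "j \<le> m" for j
  proof (cases "Suc j = q")
    case True
    with that assms(1) have "Suc m = q" "j = m" by auto
    have "((\<lambda>z. - L (x - z)) has_field_derivative - (1 / (x - z) * (0 - 1))) (at z)"
      by (intro DERIV_minus DERIV_chain2[of L] L \<open>Suc m = q\<close> derivative_intros)
    moreover have "- (1 / (x - z) * (0 - 1)) = (x - z) ^ j / (x - z) ^ q"
      using True[symmetric] assms(2) by simp
    ultimately show ?thesis using True by simp
  next
    case False
    with that assms(1) have "\<exists>k. q = Suc (Suc k) + j" by (intro exI[of _ "q - j - 2"]) auto
    then obtain k where k: "q = Suc (Suc k) + j" by blast
    have "((\<lambda>z. 1 / (of_nat (Suc k) * (x - z) ^ Suc k)) has_field_derivative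
        (x - z) ^ j / (x - z) ^ q) (at z)"
      by (rule derivative_eq_intros refl | use assms(2) in \<open>simp add: k power_add divide_simps del: of_nat_Suc\<close>)+
    then show ?thesis using False k by (simp del: of_nat_Suc)
  qed
  have "((\<lambda>z. kernel_primitive L q m a x z) has_field_derivative
      (\<Sum>j\<le>m. of_nat (m choose j) * (a - x) ^ (m - j) * ((x - z) ^ j / (x - z) ^ q))) (at z)"
    unfolding kernel_primitive_def by (intro DERIV_sum DERIV_cmult D) auto
  moreover have "(\<Sum>j\<le>m. of_nat (m choose j) * (a - x) ^ (m - j) * ((x - z) ^ j / (x - z) ^ q))
      = (a - z) ^ m / (x - z) ^ q"
    using binomial_ring[of "x - z" "a - x" m] by (simp add: sum_divide_distrib mult_ac)
  ultimately show ?thesis by simp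
qed

lemma dist_Ici_bound:
  fixes K :: "complex set"
  assumes "compact K" "K \<inter> complex_of_real ` {d..} = {}" "0 < d"
  shows "\<exists>c>0. \<forall>z\<in>K. \<forall>x\<ge>d. c * x \<le> norm (of_real x - z)"
proof (cases "K = {}")
  case False
  have "closed (complex_of_real ` {d..})"
    by (intro closed_injective_linear_image) (auto simp: inj_def linear_of_real bounded_linear.linear)
  then obtain \<rho> where \<rho>: "0 < \<rho>" "\<And>z y. z \<in> K \<Longrightarrow> y \<in> complex_of_real ` {d..} \<Longrightarrow> \<rho> \<le> dist z y"
    using separate_compact_closed[OF assms(1) _ assms(2)] by blast
  obtain R where R: "0 < R" "\<And>z. z \<in> K \<Longrightarrow> norm z \<le> R"
    using compact_imp_bounded[OF assms(1)] bounded_pos by blast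
  define c where "c = min (1/2) (\<rho> / (2 * R))"
  have "c * x \<le> norm (of_real x - z)" if "z \<in> K" "d \<le> x" for x z
  proof (cases "2 * R \<le> x")
    case True
    have "c * x \<le> 1/2 * x"
      using that assms(3) unfolding c_def by (intro mult_right_mono) auto
    also have "\<dots> \<le> norm (complex_of_real x) - norm z"
      using True R(2)[OF that(1)] that assms(3) by simp
    also have "\<dots> \<le> norm (of_real x - z)" by (rule norm_triangle_ineq2)
    finally show ?thesis .
  next
    case False
    have "c * x \<le> \<rho> / (2 * R) * (2 * R)"
      using that assms(3) False \<rho> R unfolding c_def by (intro mult_mono) auto
    also have "\<dots> = \<rho>" using R by simp
    also have "\<dots> \<le> norm (of_real x - z)"
      using \<rho>(2)[OF that(1), of "of_real x"] that by (auto simp: dist_norm norm_minus_commute)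
    finally show ?thesis .
  qed
  moreover have "c > 0" using \<rho> R by (simp add: c_def)
  ultimately show ?thesis by blast
qed (auto intro: exI[of _ 1])

lemma slit_plane:
  assumes "0 < d"
  shows "open (- complex_of_real ` {d..})" "0 \<in> - complex_of_real ` {d..}"
    "\<And>z. z \<in> - complex_of_real ` {d..} \<Longrightarrow> closed_segment 0 z \<subseteq> - complex_of_real ` {d..}"
proof -
  show "open (- complex_of_real ` {d..})"
    unfolding open_closed double_compl
    by (intro closed_injective_linear_image) (auto simp: inj_def linear_of_real bounded_linear.linear)
  show "0 \<in> - complex_of_real ` {d..}" using assms by auto
  fix z assume z: "z \<in> - complex_of_real ` {d..}"
  show "closed_segment 0 z \<subseteq> - complex_of_real ` {d..}"
  proof
    fix w assume "w \<in> closed_segment 0 z"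
    then obtain u where u: "0 \<le> u" "u \<le> 1" "w = of_real u * z"
      by (auto simp: in_segment scaleR_conv_of_real)
    show "w \<in> - complex_of_real ` {d..}"
    proof
      assume "w \<in> complex_of_real ` {d..}"
      then obtain y where y: "d \<le> y" "of_real u * z = of_real y" using u by auto
      then have "u \<noteq> 0" using assms by auto
      then have "z = of_real (y / u)" using y by (simp add: field_simps)
      moreover have "d \<le> y / u"
        using y(1) u \<open>u \<noteq> 0\<close> assms by (simp add: field_simps) (smt (verit) mult_left_le)
      ultimately have "z \<in> complex_of_real ` {d..}" by blast
      then show False using z by simp
    qed
  qed
qed

lemma kernel_primitive_diff:
  assumes "m < q"
  shows "kernel_primitive L q m a x z - kernel_primitive L' q m a x z
    = (if Suc m = q then L' (x - z) - L (x - z) else 0)"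
proof -
  have "kernel_primitive L q m a x z - kernel_primitive L' q m a x z =
      (\<Sum>j\<le>m. if j = m then (if Suc m = q then L' (x - z) - L (x - z) else 0) else 0)"
    unfolding kernel_primitive_def sum_subtractf[symmetric]
    by (intro sum.cong refl) (use assms in \<open>auto simp: algebra_simps\<close>)
  then show ?thesis by simp
qed

lemma half_circle:
  fixes x l e :: real
  assumes "0 < e" "x \<noteq> l"
  obtains c where "valid_path c" "pathstart c = Complex l (- e)" "pathfinish c = Complex l e"
    "\<And>z. z \<in> path_image c \<Longrightarrow> cmod (z - of_real l) = e"
    "\<And>z. z \<in> path_image c \<Longrightarrow> cmod (of_real x - Complex l e) \<le> cmod (of_real x - z)"
    "\<And>z. z \<in> path_image c \<Longrightarrow> (Re z - l) * (x - l) \<le> 0"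
    "\<And>f B. f contour_integrable_on c \<Longrightarrow> 0 \<le> B \<Longrightarrow> (\<And>z. z \<in> path_image c \<Longrightarrow> cmod (f z) \<le> B) \<Longrightarrow>
        cmod (contour_integral c f) \<le> B * e * pi"
proof -
  define t where "t = (if l < x then - (3 * pi / 2) else pi / 2)"
  define c where "c = part_circlepath (of_real l) e (- (pi / 2)) t"
  have ends: "pathstart c = Complex l (- e)" "pathfinish c = Complex l e"
  proof -
    have "cis (- (3 * pi / 2)) = cis (pi / 2 - 2 * pi)" by (simp add: field_simps)
    also have "\<dots> = \<i>" by (subst cis_divide[symmetric]) simp
    finally have "cis (- (3 * pi / 2)) = \<i>" .
    moreover have "cis (- (pi / 2)) = - \<i>" by (simp add: complex_eq_iff)
    ultimately show "pathstart c = Complex l (- e)" "pathfinish c = Complex l e"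
      unfolding c_def t_def pathstart_part_circlepath pathfinish_part_circlepath cis_conv_exp[symmetric]
      by (auto simp: complex_eq_iff)
  qed
  have side: "(Re z - l) * (x - l) \<le> 0" and sph: "cmod (z - of_real l) = e"
    if z: "z \<in> path_image c" for z
  proof -
    obtain \<theta> where \<theta>: "\<theta> \<in> closed_segment (- (pi / 2)) t" "z = of_real l + of_real e * cis \<theta>"
      using z unfolding c_def path_image_part_circlepath' by auto
    show "cmod (z - of_real l) = e" using assms(1) \<theta>(2) by (simp add: norm_mult)
    have "cos \<theta> * (x - l) \<le> 0"
    proof (cases "l < x")
      case True
      then have "- (3 * pi / 2) \<le> \<theta>" "\<theta> \<le> - (pi / 2)"
        using \<theta>(1) by (auto simp: t_def closed_segment_eq_real_ivl split: if_splits)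
      then have "0 \<le> cos (\<theta> + pi)" by (intro cos_ge_zero) auto
      then show ?thesis using True by (simp add: mult_nonpos_nonneg)
    next
      case False
      then have "- (pi / 2) \<le> \<theta>" "\<theta> \<le> pi / 2"
        using \<theta>(1) by (auto simp: t_def closed_segment_eq_real_ivl split: if_splits)
      then have "0 \<le> cos \<theta>" by (intro cos_ge_zero) auto
      then show ?thesis using False by (simp add: mult_nonneg_nonpos)
    qed
    then have "e * (cos \<theta> * (x - l)) \<le> 0" using assms(1) by (simp add: mult_nonneg_nonpos)
    then show "(Re z - l) * (x - l) \<le> 0" by (simp add: \<theta>(2) mult_ac)
  qed
  have far: "cmod (of_real x - Complex l e) \<le> cmod (of_real x - z)" if z: "z \<in> path_image c" for z
  proof -
    have "(Re z - l)\<^sup>2 + (Im z)\<^sup>2 = e\<^sup>2"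
      using sph[OF z] by (metis cmod_power2 minus_complex.sel Re_complex_of_real Im_complex_of_real diff_zero)
    with side[OF z] have "(x - l)\<^sup>2 + e\<^sup>2 \<le> (x - Re z)\<^sup>2 + (Im z)\<^sup>2"
      by (simp add: power2_eq_square algebra_simps)
    then show ?thesis by (simp add: cmod_def)
  qed
  have "cmod (contour_integral c f) \<le> B * e * pi"
    if "f contour_integrable_on c" "0 \<le> B" "\<And>z. z \<in> path_image c \<Longrightarrow> cmod (f z) \<le> B" for f B
  proof -
    have "cmod (contour_integral c f) \<le> B * e * \<bar>t - - (pi / 2)\<bar>"
      unfolding c_def
      by (rule contour_integral_bound_part_circlepath) (use that assms(1) in \<open>auto simp: c_def\<close>)
    also have "\<bar>t - - (pi / 2)\<bar> = pi"
      by (auto simp: t_def abs_if field_simps)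
    finally show ?thesis .
  qed
  then show ?thesis
    using that[of c] ends sph far side by (simp add: c_def)
qed

lemma has_field_derivative_divide_power:
  fixes x z :: "'a::real_normed_field"
  assumes "(Q has_field_derivative Q') (at z)" "x \<noteq> z"
  shows "((\<lambda>z. Q z / (x - z) ^ q) has_field_derivative
      Q' / (x - z) ^ q + of_nat q * Q z / (x - z) ^ Suc q) (at z)"
proof (cases q)
  case 0
  then show ?thesis using assms(1) by simp
next
  case (Suc p)
  have nz: "x - z \<noteq> 0" using assms(2) by simp
  have "((\<lambda>z. (x - z) ^ q) has_field_derivative - (of_nat q * (x - z) ^ p)) (at z)"
    unfolding Suc by (rule derivative_eq_intros refl)+ simp
  from DERIV_divide[OF assms(1) this]
  have "((\<lambda>z. Q z / (x - z) ^ q) has_field_derivative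
      (Q' * (x - z) ^ q - Q z * - (of_nat q * (x - z) ^ p)) / ((x - z) ^ q * (x - z) ^ q)) (at z)"
    using nz by simp
  also have "(Q' * (x - z) ^ q - Q z * - (of_nat q * (x - z) ^ p)) / ((x - z) ^ q * (x - z) ^ q)
      = Q' / (x - z) ^ q + of_nat q * Q z / (x - z) ^ Suc q"
  proof -
    have "(A * (v * w) - B * - (n * w)) / (v * w * (v * w)) = A / (v * w) + n * B / (v * (v * w))"
      if "v \<noteq> 0" "w \<noteq> 0" for A B n v w :: 'a
      using that by (simp add: divide_simps) (simp add: algebra_simps)
    from this[of "x - z" "(x - z) ^ p"] show ?thesis
      using nz unfolding Suc power_Suc by simp
  qed
  finally show ?thesis .
qed

definition kernel_integral :: "nat \<Rightarrow> nat \<Rightarrow> real \<Rightarrow> real \<Rightarrow> real \<Rightarrow> complex" where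
  "kernel_integral q m l e x =
     kernel_primitive Ln q m (of_real l) (of_real x) (Complex l e) -
     kernel_primitive Ln q m (of_real l) (of_real x) (Complex l (- e))"

lemma Ln_neg_minus_Ln:
  assumes "e > 0"
  shows "(Ln (- (of_real x - Complex l e)) - Ln (of_real x - Complex l e)) -
    (Ln (- (of_real x - Complex l (- e))) - Ln (of_real x - Complex l (- e))) = 2 * of_real pi * \<i>"
proof -
  have nz: "of_real x - Complex l e \<noteq> 0" "of_real x - Complex l (- e) \<noteq> 0"
    using assms by (auto simp: complex_eq_iff)
  show ?thesis
    unfolding Ln_minus[OF nz(1)] Ln_minus[OF nz(2)] using assms by simp
qed

lemma indicator_kernel_bound:
  fixes x l e :: real
  assumes q: "q > 1" and e: "0 < e" and x: "x \<noteq> l"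
  defines "\<kappa> \<equiv> (real q - 2) / real q"
  shows "cmod (of_real (indicator {..l} x) - 1 / (2 * of_real pi * \<i>) *
      (kernel_integral q (q - 1) l e x + of_real (\<kappa> * e\<^sup>2) * kernel_integral q (q - 3) l e x))
    \<le> (e / cmod (of_real x - Complex l e)) ^ Suc q"
proof -
  define \<rho> where "\<rho> = cmod (of_real x - Complex l e)"
  have \<rho>: "\<rho> > 0" using x by (auto simp: \<rho>_def complex_eq_iff)
  obtain c where c: "valid_path c" "pathstart c = Complex l (- e)" "pathfinish c = Complex l e"
    and sph: "\<And>z. z \<in> path_image c \<Longrightarrow> cmod (z - of_real l) = e"
    and far: "\<And>z. z \<in> path_image c \<Longrightarrow> \<rho> \<le> cmod (of_real x - z)"
    and side: "\<And>z. z \<in> path_image c \<Longrightarrow> (Re z - l) * (x - l) \<le> 0"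
    and bnd: "\<And>f B. f contour_integrable_on c \<Longrightarrow> 0 \<le> B \<Longrightarrow> (\<And>z. z \<in> path_image c \<Longrightarrow> cmod (f z) \<le> B) \<Longrightarrow>
        cmod (contour_integral c f) \<le> B * e * pi"
    using half_circle[OF e x] unfolding \<rho>_def by metis
  have nz: "of_real x \<noteq> z" if "z \<in> path_image c" for z
    using far[OF that] \<rho> by auto
  \<comment> \<open>The half circle lies on the far side of \<open>l\<close> from \<open>x\<close>; for \<open>x < l\<close> this forces the other
    branch of the logarithm, which accounts for the indicator function.\<close>
  define L where "L = (if l < x then Ln else (\<lambda>v. Ln (- v)))"
  define F where "F m = kernel_primitive L q m (of_real l) (of_real x) (Complex l e) -
     kernel_primitive L q m (of_real l) (of_real x) (Complex l (- e))" for m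
  have Ld: "(L has_field_derivative 1 / (of_real x - z)) (at (of_real x - z))"
    if z: "z \<in> path_image c" for z
  proof (cases "l < x")
    case True
    then have "Re z - l \<le> 0" using side[OF z] by (auto simp: mult_le_0_iff)
    then have "of_real x - z \<notin> \<real>\<^sub>\<le>\<^sub>0" using True by (auto simp: complex_nonpos_Reals_iff)
    then show ?thesis
      using True has_field_derivative_Ln by (simp add: L_def inverse_eq_divide)
  next
    case False
    with x have "x < l" by simp
    then have "0 \<le> Re z - l" using side[OF z] by (auto simp: mult_le_0_iff)
    then have "- (of_real x - z) \<notin> \<real>\<^sub>\<le>\<^sub>0" using \<open>x < l\<close> by (auto simp: complex_nonpos_Reals_iff)
    then have "((\<lambda>v. Ln (- v)) has_field_derivative inverse (- (of_real x - z)) * - 1) (at (of_real x - z))"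
      by (intro DERIV_chain2[of Ln] has_field_derivative_Ln) (auto intro!: derivative_eq_intros)
    moreover have "inverse (- (of_real x - z)) * - 1 = 1 / (of_real x - z)"
      by (metis inverse_eq_divide inverse_minus_eq minus_mult_minus mult.right_neutral)
    ultimately show ?thesis
      using False by (simp add: L_def)
  qed
  have F: "((\<lambda>z. (of_real l - z) ^ m / (of_real x - z) ^ q) has_contour_integral F m) c" if "m < q" for m
    unfolding F_def c(2,3)[symmetric]
  proof (rule contour_integral_primitive[OF _ c(1) order.refl])
    fix z assume z: "z \<in> path_image c"
    show "(kernel_primitive L q m (of_real l) (of_real x) has_field_derivative
        (of_real l - z) ^ m / (of_real x - z) ^ q) (at z within path_image c)"
      by (rule DERIV_subset[OF kernel_primitive_deriv]) (use that nz[OF z] Ld[OF z] in auto)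
  qed
  define Q where "Q z = - ((- 1) ^ q / of_nat q) * (z - of_real l) ^ (q - 2) * (of_real (e\<^sup>2) + (z - of_real l)\<^sup>2)"
    for z :: complex
  have Qd: "(Q has_field_derivative (of_real l - z) ^ (q - 1) + of_real (\<kappa> * e\<^sup>2) * (of_real l - z) ^ (q - 3)) (at z)"
    for z
  proof (cases "q = 2")
    case True
    then show ?thesis
      unfolding Q_def \<kappa>_def by (auto intro!: derivative_eq_intros simp: diff_divide_distrib)
  next
    case False
    with q have "3 \<le> q" by simp
    then obtain p where p: "q = p + 3" by (metis add.commute le_Suc_ex)
    have sgn: "(of_real l - z) ^ n = (- 1) ^ n * (z - of_real l) ^ n" for n
      by (metis minus_diff_eq power_minus)
    have "((\<lambda>z. (z - of_real l) ^ Suc p * (of_real (e\<^sup>2) + (z - of_real l)\<^sup>2)) has_field_derivative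
        of_nat (Suc p) * (z - of_real l) ^ p * (of_real (e\<^sup>2) + (z - of_real l)\<^sup>2) +
        (z - of_real l) ^ Suc p * (2 * (z - of_real l))) (at z)"
      by (auto intro!: derivative_eq_intros simp del: of_nat_Suc power_Suc simp: mult_ac)
    from DERIV_cmult[OF this, of "- ((- 1) ^ q / of_nat q)"]
    have "(Q has_field_derivative - ((- 1) ^ q / of_nat q) * (of_nat (Suc p) * (z - of_real l) ^ p *
        (of_real (e\<^sup>2) + (z - of_real l)\<^sup>2) + (z - of_real l) ^ Suc p * (2 * (z - of_real l)))) (at z)"
      unfolding Q_def[abs_def] by (simp add: p mult.assoc del: of_nat_Suc)
    also have "- ((- 1) ^ q / of_nat q) * (of_nat (Suc p) * (z - of_real l) ^ p *
        (of_real (e\<^sup>2) + (z - of_real l)\<^sup>2) + (z - of_real l) ^ Suc p * (2 * (z - of_real l)))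
      = (of_real l - z) ^ (q - 1) + of_real (\<kappa> * e\<^sup>2) * (of_real l - z) ^ (q - 3)"
    proof -
      have "(of_nat p + 3 :: complex) \<noteq> 0" by (metis of_nat_add of_nat_numeral of_nat_eq_0_iff add_is_0 zero_neq_numeral)
      then have alg: "t / (of_nat p + 3) * ((of_nat p + 1) * W * (E + w\<^sup>2) + w * W * (2 * w)) =
          t * (w\<^sup>2 * W) + (of_nat p + 1) / (of_nat p + 3) * E * (t * W)" for t W E w :: complex
        by (simp add: divide_simps) (simp add: algebra_simps power2_eq_square)
      have "complex_of_real \<kappa> = (of_nat p + 1) / (of_nat p + 3)"
        by (simp add: \<kappa>_def p)
      moreover have "- ((- 1) ^ q / of_nat q :: complex) = (- 1) ^ p / (of_nat p + 3)"
        by (simp add: p power_add)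
      moreover have "(of_real l - z) ^ (q - 1) = (- 1) ^ p * ((z - of_real l)\<^sup>2 * (z - of_real l) ^ p)"
        unfolding sgn p by (simp flip: power_add add: add.commute)
      moreover have "(of_real l - z) ^ (q - 3) = (- 1) ^ p * (z - of_real l) ^ p"
        unfolding sgn p by simp
      moreover have "of_nat (Suc p) = (of_nat p + 1 :: complex)" by simp
      ultimately show ?thesis
        using alg[of "(- 1) ^ p" "(z - of_real l) ^ p" "of_real (e\<^sup>2)" "z - of_real l"]
        by (simp only: power_Suc of_real_mult)
    qed
    finally show ?thesis .
  qed
  have parts: "((\<lambda>z. ((of_real l - z) ^ (q - 1) + of_real (\<kappa> * e\<^sup>2) * (of_real l - z) ^ (q - 3)) / (of_real x - z) ^ q
      + of_nat q * Q z / (of_real x - z) ^ Suc q) has_contour_integral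
      Q (pathfinish c) / (of_real x - pathfinish c) ^ q - Q (pathstart c) / (of_real x - pathstart c) ^ q) c"
  proof (rule contour_integral_primitive[OF _ c(1) order.refl])
    fix z assume z: "z \<in> path_image c"
    show "((\<lambda>z. Q z / (of_real x - z) ^ q) has_field_derivative
       ((of_real l - z) ^ (q - 1) + of_real (\<kappa> * e\<^sup>2) * (of_real l - z) ^ (q - 3)) / (of_real x - z) ^ q
      + of_nat q * Q z / (of_real x - z) ^ Suc q) (at z within path_image c)"
      by (rule DERIV_subset[OF has_field_derivative_divide_power]) (use Qd nz[OF z] in auto)
  qed
  have Q0: "Q (Complex l e) = 0" "Q (Complex l (- e)) = 0"
  proof -
    have "Complex l e - of_real l = \<i> * of_real e" "Complex l (- e) - of_real l = - \<i> * of_real e"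
      by (simp_all add: complex_eq_iff)
    then show "Q (Complex l e) = 0" "Q (Complex l (- e)) = 0"
      by (simp_all add: Q_def power_mult_distrib)
  qed
  define T where "T = F (q - 1) + of_real (\<kappa> * e\<^sup>2) * F (q - 3)"
  have "((\<lambda>z. (of_real l - z) ^ (q - 1) / (of_real x - z) ^ q +
      of_real (\<kappa> * e\<^sup>2) * ((of_real l - z) ^ (q - 3) / (of_real x - z) ^ q)) has_contour_integral T) c"
    unfolding T_def by (intro has_contour_integral_add has_contour_integral_lmul F) (use q in auto)
  from has_contour_integral_diff[OF parts this]
  have I: "((\<lambda>z. of_nat q * Q z / (of_real x - z) ^ Suc q) has_contour_integral - T) c"
    by (simp add: c Q0 add_divide_distrib)
  have Qb: "cmod (of_nat q * Q z / (of_real x - z) ^ Suc q) \<le> 2 * e ^ q / \<rho> ^ Suc q"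
    if z: "z \<in> path_image c" for z
  proof -
    have "cmod (of_real (e\<^sup>2) + (z - of_real l)\<^sup>2) \<le> 2 * e\<^sup>2"
      using norm_triangle_ineq[of "of_real (e\<^sup>2)" "(z - of_real l)\<^sup>2"] sph[OF z]
      by (simp add: norm_power)
    then have "cmod (of_nat q * Q z) \<le> e ^ (q - 2) * (2 * e\<^sup>2)"
      using q sph[OF z] e by (simp add: Q_def norm_mult norm_divide norm_power)
    also have "e ^ (q - 2) * (2 * e\<^sup>2) = 2 * e ^ (q - 2 + 2)"
      by (simp only: power_add mult_ac)
    also have "q - 2 + 2 = q" using q by simp
    finally show ?thesis
      unfolding norm_divide norm_power using far[OF z] \<rho> e
      by (intro frac_le power_mono) auto
  qed
  have "cmod (contour_integral c (\<lambda>z. of_nat q * Q z / (of_real x - z) ^ Suc q)) \<le> 2 * e ^ q / \<rho> ^ Suc q * e * pi"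
    by (rule bnd[OF _ _ Qb]) (use I e \<rho> in \<open>auto simp: contour_integrable_on_def\<close>)
  then have "cmod (- T) \<le> 2 * e ^ q / \<rho> ^ Suc q * e * pi"
    by (simp only: contour_integral_unique[OF I])
  then have T: "cmod T \<le> 2 * pi * (e / \<rho>) ^ Suc q"
    by (simp add: power_divide field_simps)
  have diff: "kernel_integral q m l e x - F m = (if Suc m = q \<and> x < l then 2 * of_real pi * \<i> else 0)"
    if "m < q" for m
    using kernel_primitive_diff[OF that, of Ln "of_real l" "of_real x" _ L] Ln_neg_minus_Ln[OF e, of x l] x
    unfolding kernel_integral_def F_def
    by (auto simp: L_def algebra_simps split: if_splits)
  have "kernel_integral q (q - 1) l e x + of_real (\<kappa> * e\<^sup>2) * kernel_integral q (q - 3) l e x =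
      T + 2 * of_real pi * \<i> * of_real (indicator {..l} x)"
    using diff[of "q - 1"] diff[of "q - 3"] q x by (auto simp: T_def algebra_simps indicator_def)
  then have "of_real (indicator {..l} x) - 1 / (2 * of_real pi * \<i>) *
      (kernel_integral q (q - 1) l e x + of_real (\<kappa> * e\<^sup>2) * kernel_integral q (q - 3) l e x) =
      - T / (2 * of_real pi * \<i>)"
    by (simp add: field_simps)
  also have "cmod \<dots> \<le> (e / \<rho>) ^ Suc q"
    using T by (simp add: norm_divide norm_mult field_simps)
  finally show ?thesis unfolding \<rho>_def .
qed

lemma vertical_segment:
  assumes "x \<noteq> l"
  shows "path_image (linepath (Complex l a) (Complex l b)) \<subseteq> - {complex_of_real x}"
proof
  fix z assume "z \<in> path_image (linepath (Complex l a) (Complex l b))"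
  then obtain u where "z = (1 - u) *\<^sub>R Complex l a + u *\<^sub>R Complex l b"
    by (auto simp: in_segment)
  then have "Re z = (1 - u) * l + u * l" by simp
  also have "\<dots> = l" by (simp add: algebra_simps)
  finally show "z \<in> - {complex_of_real x}" using assms by auto
qed

lemma symmetric_beta_deriv:
  fixes s :: "'a::real_normed_field"
  shows "((\<lambda>s. \<Sum>i\<le>k. of_real ((- 1) ^ i * real (k choose i) / real (Suc (k + i))) * s ^ Suc (k + i))
    has_field_derivative s ^ k * (1 - s) ^ k) (at s)"
proof -
  have "((\<lambda>s. of_real (a / real (Suc n)) * s ^ Suc n) has_field_derivative of_real a * s ^ n) (at s)"
    for a n
    by (rule derivative_eq_intros refl)+ (simp add: field_simps del: of_nat_Suc)
  then have "((\<lambda>s. \<Sum>i\<le>k. of_real ((- 1) ^ i * real (k choose i) / real (Suc (k + i))) * s ^ Suc (k + i))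
    has_field_derivative (\<Sum>i\<le>k. of_real ((- 1) ^ i * real (k choose i)) * s ^ (k + i))) (at s)"
    by (intro DERIV_sum) blast
  moreover have "(1 - s) ^ k = (\<Sum>i\<le>k. of_real ((- 1) ^ i * real (k choose i)) * s ^ i)"
    using binomial_ring[of "- s" 1 k] by (simp add: power_minus[of s] mult_ac)
  ultimately show ?thesis
    by (simp add: sum_distrib_left power_add mult_ac)
qed

lemma symmetric_beta_primitive:
  obtains h :: "complex \<Rightarrow> complex" and \<beta> :: real
  where "0 < \<beta>" "h 1 - h 0 = of_real \<beta>"
    "\<And>s. (h has_field_derivative s ^ k * (1 - s) ^ k) (at s)"
proof -
  define c where "c i = (- 1) ^ i * real (k choose i) / real (Suc (k + i))" for i
  define H where "H s = (\<Sum>i\<le>k. c i * s ^ Suc (k + i))" for s :: real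
  define h where "h s = (\<Sum>i\<le>k. of_real (c i) * s ^ Suc (k + i))" for s :: complex
  have Hd: "(H has_field_derivative s ^ k * (1 - s) ^ k) (at s)" for s
    using symmetric_beta_deriv[of k s] unfolding H_def c_def by simp
  have "H 0 < H 1"
  proof (rule DERIV_pos_imp_increasing_open[of 0 1 H])
    show "\<exists>y. (H has_field_derivative y) (at x) \<and> 0 < y" if "0 < x" "x < 1" for x
      using Hd[of x] that by (auto intro!: exI[of _ "x ^ k * (1 - x) ^ k"])
    show "continuous_on {0..1} H"
      using Hd by (meson DERIV_isCont continuous_at_imp_continuous_on)
  qed simp
  moreover have "h 1 - h 0 = of_real (H 1 - H 0)"
    by (simp add: h_def H_def)
  moreover have "(h has_field_derivative s ^ k * (1 - s) ^ k) (at s)" for s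
    using symmetric_beta_deriv[of k s] unfolding h_def c_def .
  ultimately show ?thesis using that[of "H 1 - H 0" h] by simp
qed

lemma quadratic_kernel_integral:
  "\<exists>\<beta>>0. \<forall>x l e. 0 < e \<longrightarrow> x \<noteq> l \<longrightarrow>
    ((\<lambda>z. (of_real (e\<^sup>2) + (z - of_real l)\<^sup>2) ^ k / (of_real x - z) ^ (2 * k + 2)) has_contour_integral
      \<i> * of_real (\<beta> * e ^ (2 * k + 1) / cmod (of_real x - Complex l e) ^ (2 * k + 2)))
      (linepath (Complex l (- e)) (Complex l e))"
proof -
  obtain h :: "complex \<Rightarrow> complex" and \<beta> :: real
    where \<beta>: "0 < \<beta>" "h 1 - h 0 = of_real \<beta>"
      and hd: "\<And>s. (h has_field_derivative s ^ k * (1 - s) ^ k) (at s)"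
    by (rule symmetric_beta_primitive[of k]) blast
  have "((\<lambda>z. (of_real (e\<^sup>2) + (z - of_real l)\<^sup>2) ^ k / (of_real x - z) ^ (2 * k + 2)) has_contour_integral
      \<i> * of_real ((2 * 4 ^ k * \<beta>) * e ^ (2 * k + 1) / cmod (of_real x - Complex l e) ^ (2 * k + 2)))
      (linepath (Complex l (- e)) (Complex l e))"
    if e: "0 < e" and x: "x \<noteq> l" for x l e :: real
  proof -
    define A B where "A = Complex l e" and "B = Complex l (- e)"
    define r where "r = (of_real x - A) * (of_real x - B)"
    define E where "E = (of_real e :: complex)"
    define X where "X = (of_real x :: complex)"
    define w where "w = (of_real l :: complex)"
    have nz: "X - A \<noteq> 0" "X - B \<noteq> 0" "E \<noteq> 0"
      using x e by (auto simp: A_def B_def E_def X_def complex_eq_iff)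
    have AB: "A = w + \<i> * E" "B = w - \<i> * E"
      by (simp_all add: A_def B_def w_def E_def complex_eq_iff)
    have r: "r = of_real ((cmod (of_real x - Complex l e))\<^sup>2)" "r \<noteq> 0"
    proof -
      have "of_real x - B = cnj (of_real x - A)" by (simp add: A_def B_def complex_eq_iff)
      then show "r = of_real ((cmod (of_real x - Complex l e))\<^sup>2)"
        unfolding r_def complex_norm_square A_def by simp
      show "r \<noteq> 0" using nz by (simp add: r_def X_def)
    qed
    \<comment> \<open>The Moebius transformation sending the endpoints \<open>B\<close>, \<open>A\<close> to \<open>0\<close>, \<open>1\<close> and \<open>x\<close> to \<open>\<infinity>\<close> turns the
      integrand into a multiple of \<open>s ^ k * (1 - s) ^ k\<close>.\<close>
    define c where "c = A - B"
    have c: "c \<noteq> 0" "c = 2 * \<i> * E" "- c\<^sup>2 = 4 * E\<^sup>2"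
      using nz by (simp_all add: c_def AB power_mult_distrib)
    define s where "s z = (z - B) * (X - A) / ((X - z) * c)" for z
    define K where "K = (- c\<^sup>2) ^ k * c / r ^ (k + 1)"
    have "((\<lambda>z. (E\<^sup>2 + (z - w)\<^sup>2) ^ k / (X - z) ^ (2 * k + 2)) has_contour_integral
      K * h (s (pathfinish (linepath B A))) - K * h (s (pathstart (linepath B A)))) (linepath B A)"
    proof (rule contour_integral_primitive[where S = "- {X}"])
      fix z assume "z \<in> - {X}"
      then have z: "X - z \<noteq> 0" by auto
      have rX: "r = (X - A) * (X - B)" by (simp add: r_def X_def)
      have "(s has_field_derivative
          ((X - A) * ((X - z) * c) + (z - B) * (X - A) * c) / (((X - z) * c) * ((X - z) * c))) (at z)"
        unfolding s_def by (rule derivative_eq_intros refl | use z c in simp)+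
      also have "(X - A) * ((X - z) * c) + (z - B) * (X - A) * c = r * c"
        by (simp add: rX algebra_simps)
      finally have sd: "(s has_field_derivative r / (c * (X - z)\<^sup>2)) (at z)"
        using c(1) z by (simp add: power2_eq_square mult_ac)
      have "1 - s z = ((X - z) * c - (z - B) * (X - A)) / ((X - z) * c)"
        using z c(1) by (simp add: s_def diff_divide_distrib)
      also have "(X - z) * c - (z - B) * (X - A) = (A - z) * (X - B)"
        by (simp add: c_def algebra_simps)
      finally have "s z * (1 - s z) = (z - B) * (A - z) * r / ((X - z)\<^sup>2 * c\<^sup>2)"
        unfolding s_def rX power2_eq_square by (simp only: times_divide_times_eq mult_ac)
      also have "(z - B) * (A - z) = - (E\<^sup>2 + (z - w)\<^sup>2)"
        unfolding AB by (simp add: power2_eq_square algebra_simps)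
      also have "- (E\<^sup>2 + (z - w)\<^sup>2) * r / ((X - z)\<^sup>2 * c\<^sup>2)
          = (E\<^sup>2 + (z - w)\<^sup>2) * r / ((X - z)\<^sup>2 * (- c\<^sup>2))"
        by (simp del: minus_add_distrib)
      finally have ss: "s z ^ k * (1 - s z) ^ k = ((E\<^sup>2 + (z - w)\<^sup>2) * r / ((X - z)\<^sup>2 * (- c\<^sup>2))) ^ k"
        by (simp only: flip: power_mult_distrib)
      have "((\<lambda>z. K * h (s z)) has_field_derivative K * (s z ^ k * (1 - s z) ^ k * (r / (c * (X - z)\<^sup>2)))) (at z)"
        by (intro DERIV_cmult DERIV_chain2[OF hd sd])
      also have "K * (s z ^ k * (1 - s z) ^ k * (r / (c * (X - z)\<^sup>2)))
          = (E\<^sup>2 + (z - w)\<^sup>2) ^ k / ((X - z)\<^sup>2 ^ k * (X - z)\<^sup>2)"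
        unfolding ss K_def power_divide power_mult_distrib using z c(1) r(2) by simp
      also have "(X - z)\<^sup>2 ^ k * (X - z)\<^sup>2 = (X - z) ^ (2 * k + 2)"
        by (simp only: power_add power_mult)
      finally show "((\<lambda>z. K * h (s z)) has_field_derivative (E\<^sup>2 + (z - w)\<^sup>2) ^ k / (X - z) ^ (2 * k + 2))
          (at z within - {X})"
        by (rule DERIV_subset) simp
    next
      show "path_image (linepath B A) \<subseteq> - {X}"
        using vertical_segment[OF x] by (simp only: A_def B_def X_def)
    qed simp
    moreover have "s A = 1" "s B = 0"
      using nz c(1) unfolding s_def by (auto simp: c_def)
    moreover have "K * h 1 - K * h 0 = \<i> * of_real ((2 * 4 ^ k * \<beta>) * e ^ (2 * k + 1) / cmod (of_real x - Complex l e) ^ (2 * k + 2))"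
    proof -
      have "r ^ (k + 1) = of_real (cmod (of_real x - Complex l e) ^ (2 * (k + 1)))"
        by (simp only: r(1) power_mult of_real_power)
      moreover have "(- c\<^sup>2) ^ k * c = (4 * E\<^sup>2) ^ k * (2 * \<i> * E)"
        by (simp only: c(3)) (simp only: c(2))
      ultimately have "K = (4 * E\<^sup>2) ^ k * (2 * \<i> * E) / of_real (cmod (of_real x - Complex l e) ^ (2 * k + 2))"
        by (simp only: K_def) simp
      moreover have "(4 * E\<^sup>2) ^ k * (2 * \<i> * E) / of_real (cmod (of_real x - Complex l e) ^ (2 * k + 2)) * of_real \<beta>
          = \<i> * of_real ((2 * 4 ^ k * \<beta>) * e ^ (2 * k + 1) / cmod (of_real x - Complex l e) ^ (2 * k + 2))"
        by (simp add: E_def power_mult_distrib mult_ac flip: power_mult)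
      moreover have "K * h 1 - K * h 0 = K * of_real \<beta>" by (simp flip: \<beta>(2) add: algebra_simps)
      ultimately show ?thesis by (simp only:)
    qed
    ultimately show ?thesis by (simp add: A_def B_def E_def X_def w_def)
  qed
  then show ?thesis
    by (intro exI[of _ "2 * 4 ^ k * \<beta>"]) (use \<beta>(1) in auto)
qed

lemma kernel_integral_linepath:
  assumes "Suc m < q" "x \<noteq> l"
  shows "((\<lambda>z. (of_real l - z) ^ m / (of_real x - z) ^ q) has_contour_integral kernel_integral q m l e x)
    (linepath (Complex l (- e)) (Complex l e))"
proof -
  have "((\<lambda>z. (of_real l - z) ^ m / (of_real x - z) ^ q) has_contour_integral
     kernel_primitive Ln q m (of_real l) (of_real x) (pathfinish (linepath (Complex l (- e)) (Complex l e))) -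
     kernel_primitive Ln q m (of_real l) (of_real x) (pathstart (linepath (Complex l (- e)) (Complex l e))))
    (linepath (Complex l (- e)) (Complex l e))"
  proof (rule contour_integral_primitive[where S = "- {of_real x}"])
    show "(kernel_primitive Ln q m (of_real l) (of_real x) has_field_derivative
        (of_real l - z) ^ m / (of_real x - z) ^ q) (at z within - {of_real x})"
      if "z \<in> - {of_real x}" for z
      by (rule DERIV_subset[OF kernel_primitive_deriv]) (use that assms in auto)
    show "path_image (linepath (Complex l (- e)) (Complex l e)) \<subseteq> - {of_real x}"
      using assms(2) by (rule vertical_segment)
  qed simp
  then show ?thesis by (simp add: kernel_integral_def)
qed

lemma poly_homogenize:
  fixes p :: "'a::field poly"
  assumes "degree p \<le> n" "E \<noteq> 0"
  shows "(\<Sum>m=0..n. coeff p m * E ^ (Suc n - m) * w ^ m) = E ^ Suc n * poly p (w / E)"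
proof -
  have "poly p (w / E) = (\<Sum>m=0..n. coeff p m * (w / E) ^ m)"
    unfolding poly_altdef
    by (rule sum.mono_neutral_left) (use assms in \<open>auto simp: coeff_eq_0\<close>)
  then have "E ^ Suc n * poly p (w / E) = (\<Sum>m=0..n. E ^ Suc n * (coeff p m * (w / E) ^ m))"
    by (simp only: sum_distrib_left)
  also have "\<dots> = (\<Sum>m=0..n. coeff p m * E ^ (Suc n - m) * w ^ m)"
    using assms(2) by (intro sum.cong refl) (simp add: power_diff power_divide)
  finally show ?thesis ..
qed

lemma kernel_integral_combination:
  fixes p :: "complex poly"
  assumes "q > 1" "degree p \<le> q - 2" "0 < e" "x \<noteq> l"
  shows "((\<lambda>z. of_real e ^ (q - 1) * poly p ((of_real l - z) / of_real e) / (of_real x - z) ^ q)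
    has_contour_integral (\<Sum>m=0..q - 2. coeff p m * of_real (e ^ (q - 1 - m)) * kernel_integral q m l e x))
    (linepath (Complex l (- e)) (Complex l e))"
proof -
  have "((\<lambda>z. \<Sum>m=0..q - 2. coeff p m * of_real (e ^ (q - 1 - m)) * ((of_real l - z) ^ m / (of_real x - z) ^ q))
    has_contour_integral (\<Sum>m=0..q - 2. coeff p m * of_real (e ^ (q - 1 - m)) * kernel_integral q m l e x))
    (linepath (Complex l (- e)) (Complex l e))"
    by (intro has_contour_integral_sum has_contour_integral_lmul kernel_integral_linepath)
      (use assms in auto)
  moreover have "(\<Sum>m=0..q - 2. coeff p m * of_real (e ^ (q - 1 - m)) * ((of_real l - z) ^ m / (of_real x - z) ^ q))
      = of_real e ^ (q - 1) * poly p ((of_real l - z) / of_real e) / (of_real x - z) ^ q" for z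
    using poly_homogenize[OF assms(2), of "of_real e" "of_real l - z"] assms(1,3)
    by (simp add: Suc_diff_Suc numeral_2_eq_2 flip: sum_divide_distrib)
  ultimately show ?thesis by simp
qed

lemma kernel_integral_positive_combination:
  assumes q: "q > 1"
  shows "\<exists>(a :: nat \<Rightarrow> complex) (c :: real). 0 < c \<and> (\<forall>x l e. 0 < e \<longrightarrow> x \<noteq> l \<longrightarrow>
    c * (e / cmod (of_real x - Complex l e)) ^ Suc q \<le>
      Im (\<Sum>m=0..q - 2. a m * of_real (e ^ (q - 1 - m)) * kernel_integral q m l e x))"
proof (cases "even q")
  case True
  with q obtain k where k: "q = 2 * k + 2"
    by (metis even_Suc evenE Suc_1 Suc_leI add.commute le_Suc_ex dvd_add_triv_left_iff dvd_refl)
  obtain \<beta> where \<beta>: "0 < \<beta>" "\<And>x l e. 0 < e \<Longrightarrow> x \<noteq> l \<Longrightarrow>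
    ((\<lambda>z. (of_real (e\<^sup>2) + (z - of_real l)\<^sup>2) ^ k / (of_real x - z) ^ (2 * k + 2)) has_contour_integral
      \<i> * of_real (\<beta> * e ^ (2 * k + 1) / cmod (of_real x - Complex l e) ^ (2 * k + 2)))
      (linepath (Complex l (- e)) (Complex l e))"
    using quadratic_kernel_integral[of k] by blast
  define p :: "complex poly" where "p = [:1, 0, 1:] ^ k"
  have deg: "degree p \<le> q - 2" unfolding p_def k using degree_power_le[of "[:1, 0, 1:] :: complex poly" k] by simp
  have "\<beta> * (e / cmod (of_real x - Complex l e)) ^ Suc q \<le>
      Im (\<Sum>m=0..q - 2. coeff p m * of_real (e ^ (q - 1 - m)) * kernel_integral q m l e x)"
    if e: "0 < e" and x: "x \<noteq> l" for x l e :: real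
  proof -
    define \<rho> where "\<rho> = cmod (of_real x - Complex l e)"
    have \<rho>: "e \<le> \<rho>" using abs_Im_le_cmod[of "of_real x - Complex l e"] e by (simp add: \<rho>_def)
    have "of_real e ^ (q - 1) * poly p ((of_real l - z) / of_real e) / (of_real x - z) ^ q
       = of_real e * ((of_real (e\<^sup>2) + (z - of_real l)\<^sup>2) ^ k / (of_real x - z) ^ (2 * k + 2))" for z
    proof -
      have "of_real e ^ (q - 1) * poly p ((of_real l - z) / of_real e)
        = of_real e * ((of_real e)\<^sup>2 * (1 + ((of_real l - z) / of_real e)\<^sup>2)) ^ k"
        by (simp add: k p_def power_mult_distrib power_mult power2_eq_square)
      also have "(of_real e)\<^sup>2 * (1 + ((of_real l - z) / of_real e)\<^sup>2) = of_real (e\<^sup>2) + (z - of_real l)\<^sup>2"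
        using e by (simp add: field_simps power2_commute)
      finally show ?thesis by (simp add: k)
    qed
    then have "((\<lambda>z. of_real e ^ (q - 1) * poly p ((of_real l - z) / of_real e) / (of_real x - z) ^ q) has_contour_integral
        of_real e * (\<i> * of_real (\<beta> * e ^ (2 * k + 1) / \<rho> ^ (2 * k + 2)))) (linepath (Complex l (- e)) (Complex l e))"
      using has_contour_integral_lmul[OF \<beta>(2)[OF e x], of "of_real e"] by (simp add: \<rho>_def)
    from contour_integral_unique[OF kernel_integral_combination[OF q deg e x]] contour_integral_unique[OF this]
    have "(\<Sum>m=0..q - 2. coeff p m * of_real (e ^ (q - 1 - m)) * kernel_integral q m l e x)
      = of_real e * (\<i> * of_real (\<beta> * e ^ (2 * k + 1) / \<rho> ^ (2 * k + 2)))" by simp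
    then have "Im (\<Sum>m=0..q - 2. coeff p m * of_real (e ^ (q - 1 - m)) * kernel_integral q m l e x)
      = \<beta> * (e / \<rho>) ^ q"
      by (simp add: k power_divide)
    moreover have "\<beta> * (e / \<rho>) ^ Suc q \<le> \<beta> * (e / \<rho>) ^ q"
      using \<rho> e \<beta>(1) by (intro mult_left_mono power_decreasing) auto
    ultimately show ?thesis by (simp only: \<rho>_def)
  qed
  then show ?thesis using \<beta>(1) by (intro exI[of _ "coeff p"] exI[of _ \<beta>]) blast
next
  case False
  then obtain j where "q = 2 * j + 1" by (blast elim: oddE)
  with q obtain k where k: "q = 2 * k + 3"
    by (cases j) auto
  obtain \<beta> where \<beta>: "0 < \<beta>" "\<And>x l e. 0 < e \<Longrightarrow> x \<noteq> l \<Longrightarrow>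
    ((\<lambda>z. (of_real (e\<^sup>2) + (z - of_real l)\<^sup>2) ^ Suc k / (of_real x - z) ^ (2 * Suc k + 2)) has_contour_integral
      \<i> * of_real (\<beta> * e ^ (2 * Suc k + 1) / cmod (of_real x - Complex l e) ^ (2 * Suc k + 2)))
      (linepath (Complex l (- e)) (Complex l e))"
    using quadratic_kernel_integral[of "Suc k"] by blast
  define p :: "complex poly" where "p = [:0, 1:] * [:1, 0, 1:] ^ k"
  have deg: "degree p \<le> q - 2"
    unfolding p_def k using degree_power_le[of "[:1, 0, 1:] :: complex poly" k]
    by (intro order.trans[OF degree_mult_le]) simp
  define c where "c = \<beta> * (real q / (2 * real (Suc k)))"
  have c: "0 < c" using \<beta>(1) q by (simp add: c_def)
  have "c * (e / cmod (of_real x - Complex l e)) ^ Suc q \<le>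
      Im (\<Sum>m=0..q - 2. coeff p m * of_real (e ^ (q - 1 - m)) * kernel_integral q m l e x)"
    if e: "0 < e" and x: "x \<noteq> l" for x l e :: real
  proof -
    define \<rho> where "\<rho> = cmod (of_real x - Complex l e)"
    define P where "P = linepath (Complex l (- e)) (Complex l e)"
    define Q where "Q z = of_real (e\<^sup>2) + (z - of_real l)\<^sup>2" for z :: complex
    define f where "f z = of_real e ^ (q - 1) * poly p ((of_real l - z) / of_real e) / (of_real x - z) ^ q" for z
    have f: "f z = - of_real e * ((z - of_real l) * Q z ^ k / (of_real x - z) ^ q)" for z
    proof -
      have "of_real e ^ (q - 1) * poly p ((of_real l - z) / of_real e)
        = of_real e * (of_real l - z) * ((of_real e)\<^sup>2 * (1 + ((of_real l - z) / of_real e)\<^sup>2)) ^ k"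
        using e by (simp add: k p_def power_mult_distrib power_mult power2_eq_square)
      also have "(of_real e)\<^sup>2 * (1 + ((of_real l - z) / of_real e)\<^sup>2) = Q z"
        using e by (simp add: Q_def field_simps power2_commute)
      finally show ?thesis by (simp add: f_def algebra_simps)
    qed
    have "((\<lambda>z. 2 * of_nat (Suc k) * ((z - of_real l) * Q z ^ k / (of_real x - z) ^ q) +
        of_nat q * (Q z ^ Suc k / (of_real x - z) ^ Suc q)) has_contour_integral
        Q (pathfinish P) ^ Suc k / (of_real x - pathfinish P) ^ q -
        Q (pathstart P) ^ Suc k / (of_real x - pathstart P) ^ q) P"
    proof (rule contour_integral_primitive[where S = "- {of_real x}"])
      fix z assume "z \<in> - {complex_of_real x}"
      then have z: "of_real x - z \<noteq> 0" by auto
      have Qd: "(Q has_field_derivative 2 * (z - of_real l)) (at z)"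
        unfolding Q_def by (rule derivative_eq_intros refl | simp)+
      have "((\<lambda>z. Q z ^ Suc k) has_field_derivative
          2 * of_nat (Suc k) * ((z - of_real l) * Q z ^ k)) (at z)"
        by (rule derivative_eq_intros Qd refl)+ (simp add: mult_ac del: of_nat_Suc)
      from has_field_derivative_divide_power[OF this, of "of_real x" q] z
      have "((\<lambda>z. Q z ^ Suc k / (of_real x - z) ^ q) has_field_derivative
        2 * of_nat (Suc k) * ((z - of_real l) * Q z ^ k / (of_real x - z) ^ q) +
        of_nat q * (Q z ^ Suc k / (of_real x - z) ^ Suc q)) (at z)"
        unfolding times_divide_eq_right by fastforce
      then show "((\<lambda>z. Q z ^ Suc k / (of_real x - z) ^ q) has_field_derivative
        2 * of_nat (Suc k) * ((z - of_real l) * Q z ^ k / (of_real x - z) ^ q) +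
        of_nat q * (Q z ^ Suc k / (of_real x - z) ^ Suc q)) (at z within - {of_real x})"
        by (rule DERIV_subset) simp
    next
      show "path_image P \<subseteq> - {complex_of_real x}"
        unfolding P_def using x by (rule vertical_segment)
    qed (simp add: P_def)
    moreover have "Q (Complex l e) = 0" "Q (Complex l (- e)) = 0"
      by (simp_all add: Q_def complex_eq_iff power2_eq_square)
    ultimately have parts: "((\<lambda>z. 2 * of_nat (Suc k) * ((z - of_real l) * Q z ^ k / (of_real x - z) ^ q) +
        of_nat q * (Q z ^ Suc k / (of_real x - z) ^ Suc q)) has_contour_integral 0) P"
      by (simp add: P_def)
    have "((\<lambda>z. Q z ^ Suc k / (of_real x - z) ^ Suc q) has_contour_integral
        \<i> * of_real (\<beta> * e ^ q / \<rho> ^ Suc q)) P"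
      using \<beta>(2)[OF e x] by (simp add: k Q_def P_def \<rho>_def numeral_3_eq_3)
    from has_contour_integral_lmul[OF has_contour_integral_diff[OF parts has_contour_integral_lmul[OF this, of "of_nat q"]],
        of "- of_real e / (2 * of_nat (Suc k))"]
    have "(f has_contour_integral (- of_real e / (2 * of_nat (Suc k))) *
        (0 - of_nat q * (\<i> * of_real (\<beta> * e ^ q / \<rho> ^ Suc q)))) P"
    proof (rule has_contour_integral_eq)
      fix z
      have "- E / (2 * n) * (2 * n * A + B - B) = - E * A" if "n \<noteq> 0" for E n A B :: complex
        using that by simp
      from this[OF of_nat_neq_0] show "- of_real e / (2 * of_nat (Suc k)) *
          (2 * of_nat (Suc k) * ((z - of_real l) * Q z ^ k / (of_real x - z) ^ q) +
           of_nat q * (Q z ^ Suc k / (of_real x - z) ^ Suc q) -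
           of_nat q * (Q z ^ Suc k / (of_real x - z) ^ Suc q)) = f z"
        unfolding f .
    qed
    also have "(- of_real e / (2 * of_nat (Suc k))) * (0 - of_nat q * (\<i> * of_real (\<beta> * e ^ q / \<rho> ^ Suc q)))
        = \<i> * of_real (c * (e / \<rho>) ^ Suc q)"
      by (simp add: c_def power_divide del: of_nat_Suc)
    finally have "(\<Sum>m=0..q - 2. coeff p m * of_real (e ^ (q - 1 - m)) * kernel_integral q m l e x)
        = \<i> * of_real (c * (e / \<rho>) ^ Suc q)"
      using contour_integral_unique[OF kernel_integral_combination[OF q deg e x]]
      by (simp add: f_def P_def contour_integral_unique)
    then have "Im (\<Sum>m=0..q - 2. coeff p m * of_real (e ^ (q - 1 - m)) * kernel_integral q m l e x)
        = c * (e / \<rho>) ^ Suc q" by simp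
    then show ?thesis by (simp only: \<rho>_def order.refl)
  qed
  then show ?thesis using c by (intro exI[of _ "coeff p"] exI[of _ c]) blast
qed

lemma contour_integral_kernel_transform:
  fixes M :: "real measure"
  assumes M: "sets M = sets (restrict_space borel {d..})" "0 < d"
    and int: "integrable M (\<lambda>x. 1 / x ^ q)"
    and m: "m < q"
    and \<Gamma>: "valid_path \<Gamma>" "path_image \<Gamma> \<inter> complex_of_real ` {0<..} = {}"
      "pathstart \<Gamma> = Complex l (- e)" "pathfinish \<Gamma> = Complex l e"
  shows "integrable M (kernel_integral q m l e)"
    and "((\<lambda>z. (\<integral>x. 1 / (of_real x - z) ^ q \<partial>M) * (of_real l - z) ^ m) has_contour_integral
           (\<integral>x. kernel_integral q m l e x \<partial>M)) \<Gamma>"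
proof -
  define U where "U = - complex_of_real ` {d..}"
  note U = slit_plane[OF M(2), folded U_def]
  have space: "space M = {d..}"
    using sets_eq_imp_space_eq[OF M(1)] by (simp add: space_restrict_space)
  have slit: "of_real x - z \<notin> \<real>\<^sub>\<le>\<^sub>0" if "x \<in> space M" "z \<in> U" for x z
  proof
    assume "of_real x - z \<in> \<real>\<^sub>\<le>\<^sub>0"
    then obtain r where r: "of_real x - z = of_real r" "r \<le> 0" by (auto elim: nonpos_Reals_cases)
    then have "z = of_real (x - r)" by (simp add: algebra_simps)
    moreover have "d \<le> x - r" using that(1) r(2) by (simp add: space)
    ultimately have "z \<in> complex_of_real ` {d..}" by blast
    then show False using that(2) by (simp add: U_def)
  qed
  have nz: "of_real x \<noteq> z" if "x \<in> space M" "z \<in> U" for x z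
    using slit[OF that] by auto
  define f where "f x = kernel_primitive Ln q m (of_real l) (of_real x)" for x :: real
  define f' where "f' x z = (of_real l - z) ^ m / (of_real x - z) ^ q" for x :: real and z :: complex
  have image: "path_image \<Gamma> \<subseteq> U"
    using \<Gamma>(2) M(2) by (auto simp: U_def)
  have deriv: "(f x has_field_derivative f' x z) (at z)" if "x \<in> space M" "z \<in> U" for x z
    unfolding f_def f'_def using m nz[OF that] slit[OF that] has_field_derivative_Ln
    by (intro kernel_primitive_deriv) (auto simp: inverse_eq_divide)
  have meas: "(\<lambda>x. f x z) \<in> borel_measurable M" if z: "z \<in> U" for z
  proof -
    have "continuous_on {d..} (\<lambda>x. if Suc j = q then - Ln (of_real x - z)
        else 1 / (of_nat (q - 1 - j) * (of_real x - z) ^ (q - 1 - j)))" if "j \<le> m" for j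
    proof (cases "Suc j = q")
      case True
      then show ?thesis using slit[OF _ z] by (auto intro!: continuous_intros simp: space)
    next
      case False
      with that m have "q - 1 - j \<noteq> 0" by simp
      then show ?thesis using nz[OF _ z] False
        by (auto intro!: continuous_intros simp: space simp del: of_nat_diff)
    qed
    then have "continuous_on {d..} (\<lambda>x. f x z)"
      unfolding f_def kernel_primitive_def by (intro continuous_intros) auto
    then show ?thesis
      unfolding measurable_cong_sets[OF M(1) refl] by (rule borel_measurable_continuous_on_restrict)
  qed
  have dom: "\<exists>g. integrable M g \<and> (\<forall>x\<in>space M. \<forall>z\<in>K. norm (f' x z) \<le> g x)"
    if K: "compact K" "K \<subseteq> U" for K
  proof -
    have "K \<inter> complex_of_real ` {d..} = {}" using K(2) by (auto simp: U_def)
    from dist_Ici_bound[OF K(1) this M(2)] obtain c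
      where c: "0 < c" "\<And>z x. z \<in> K \<Longrightarrow> d \<le> x \<Longrightarrow> c * x \<le> norm (of_real x - z)" by blast
    have "compact ((\<lambda>z. (of_real l - z) ^ m) ` K)"
      by (intro compact_continuous_image continuous_intros K(1))
    then obtain B where B: "0 < B" "\<And>z. z \<in> K \<Longrightarrow> norm ((of_real l - z) ^ m) \<le> B"
      using compact_imp_bounded bounded_pos by (metis imageI)
    have "norm (f' x z) \<le> B / c ^ q * (1 / x ^ q)" if "x \<in> space M" "z \<in> K" for x z
    proof -
      have x: "d \<le> x" "0 < x" using that(1) M(2) by (auto simp: space)
      have "norm (f' x z) \<le> B / (c * x) ^ q"
        unfolding f'_def norm_divide norm_power[of _ q]
        using B c x that(2) by (intro frac_le power_mono) auto
      then show ?thesis by (simp add: power_mult_distrib)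
    qed
    moreover have "integrable M (\<lambda>x. B / c ^ q * (1 / x ^ q))"
      using int by (rule integrable_mult_right)
    ultimately show ?thesis by blast
  qed
  have eq: "kernel_integral q m l e = (\<lambda>x. f x (pathfinish \<Gamma>) - f x (pathstart \<Gamma>))"
    by (simp add: kernel_integral_def f_def \<Gamma> fun_eq_iff)
  note R = contour_integral_of_integral[OF U deriv meas dom \<Gamma>(1) image]
  show "integrable M (kernel_integral q m l e)"
    unfolding eq using R(1) .
  show "((\<lambda>z. (\<integral>x. 1 / (of_real x - z) ^ q \<partial>M) * (of_real l - z) ^ m) has_contour_integral
           (\<integral>x. kernel_integral q m l e x \<partial>M)) \<Gamma>"
    unfolding eq
  proof (rule has_contour_integral_eq[OF R(2)])
    fix z assume "z \<in> path_image \<Gamma>"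
    have "(\<integral>x. f' x z \<partial>M) = (\<integral>x. (1 / (of_real x - z) ^ q) * (of_real l - z) ^ m \<partial>M)"
      by (simp add: f'_def)
    also have "\<dots> = (\<integral>x. 1 / (of_real x - z) ^ q \<partial>M) * (of_real l - z) ^ m"
      by (rule integral_mult_left_zero)
    finally show "(\<integral>x. f' x z \<partial>M) = (\<integral>x. 1 / (of_real x - z) ^ q \<partial>M) * (of_real l - z) ^ m" .
  qed
qed

lemma stieltjes_restrict_space:
  assumes N: "mono_on {0<..} N" "\<forall>\<^sub>F x in at_right 0. N x = 0"
    and fin: "(\<integral>\<^sup>+x\<in>{0<..}. ennreal (1 / x ^ q) \<partial>stieltjes N) < \<infinity>"
  obtains d where "0 < d"
    "integrable (restrict_space (stieltjes N) {d..}) (\<lambda>x. 1 / x ^ q)"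
    "\<And>z. stieltjes_transform q N z = (\<integral>x. 1 / (of_real x - z) ^ q \<partial>restrict_space (stieltjes N) {d..})"
    "AE x in stieltjes N. d \<le> x"
proof -
  obtain \<delta> where \<delta>: "0 < \<delta>" "\<And>x. x < \<delta> \<Longrightarrow> right_limit N x = 0"
    using right_limit_zero[OF N] by blast
  define d where "d = \<delta> / 2"
  have d: "0 < d" "right_limit N d = 0" using \<delta> by (auto simp: d_def)
  have S: "sets (stieltjes N) = sets borel" "space (stieltjes N) = UNIV"
    by (simp_all add: stieltjes_def)
  note [measurable_cong] = S(1)
  have "{- real n<..d} \<in> null_sets (stieltjes N)" for n
    using emeasure_stieltjes_Ioc[OF N, of "- real n" d] d \<delta>
    by (intro null_setsI) (auto simp: S)
  then have "(\<Union>n. {- real n<..d}) \<in> null_sets (stieltjes N)"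
    by (rule null_sets_UN)
  moreover have "x \<in> (\<Union>n. {- real n<..d})" if "\<not> d \<le> x" for x
  proof -
    obtain n where "- x < real n" using reals_Archimedean2 by blast
    with that have "x \<in> {- real n<..d}" by auto
    then show ?thesis by blast
  qed
  ultimately have AE: "AE x in stieltjes N. d \<le> x"
    by (intro AE_I'[of "\<Union>n. {- real n<..d}"]) auto
  have Om: "{d..} \<inter> space (stieltjes N) \<in> sets (stieltjes N)" by (simp add: S)
  have int: "integrable (restrict_space (stieltjes N) {d..}) (\<lambda>x. 1 / x ^ q)"
  proof (rule integrableI_nonneg)
    show "(\<lambda>x. 1 / x ^ q) \<in> borel_measurable (restrict_space (stieltjes N) {d..})"
      by (intro measurable_restrict_space1) measurable
    show "AE x in restrict_space (stieltjes N) {d..}. 0 \<le> 1 / x ^ q"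
      using d by (intro AE_I2) (auto simp: space_restrict_space)
    have "(\<integral>\<^sup>+x. ennreal (1 / x ^ q) \<partial>restrict_space (stieltjes N) {d..}) =
        (\<integral>\<^sup>+x\<in>{d..}. ennreal (1 / x ^ q) \<partial>stieltjes N)"
      using Om by (rule nn_integral_restrict_space)
    also have "\<dots> \<le> (\<integral>\<^sup>+x\<in>{0<..}. ennreal (1 / x ^ q) \<partial>stieltjes N)"
      using d by (intro nn_integral_mono) (auto simp: indicator_def)
    finally show "(\<integral>\<^sup>+x. ennreal (1 / x ^ q) \<partial>restrict_space (stieltjes N) {d..}) < \<infinity>"
      using fin by (rule le_less_trans)
  qed
  have trans: "stieltjes_transform q N z = (\<integral>x. 1 / (of_real x - z) ^ q \<partial>restrict_space (stieltjes N) {d..})" for z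
  proof -
    have "stieltjes_transform q N z = (LINT x:{d..}|stieltjes N. 1 / (complex_of_real x - z) ^ q)"
      unfolding stieltjes_transform_def
    proof (rule set_integral_cong_set)
      show "AE x in stieltjes N. x \<in> {d..} \<longleftrightarrow> x \<in> {0<..}"
        using AE by eventually_elim (use d in auto)
    qed (auto simp: set_borel_measurable_def)
    then show ?thesis
      by (simp add: set_lebesgue_integral_def integral_restrict_space[OF Om])
  qed
  show ?thesis using that[OF d(1) int trans AE] .
qed

lemma stieltjes_locally_constant:
  assumes N: "mono_on {0<..} N" "\<forall>\<^sub>F x in at_right 0. N x = 0"
    and l: "0 < l" "\<forall>\<^sub>F x in nhds l. N x = N l"
  shows "emeasure (stieltjes N) {0<..l} = ennreal (N l)" "0 \<le> N l"
    "AE x in stieltjes N. x \<noteq> l"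
proof -
  obtain r where r: "0 < r" "\<And>x. \<bar>x - l\<bar> < r \<Longrightarrow> N x = N l"
    using l(2) unfolding eventually_nhds_metric by (auto simp: dist_real_def)
  have rl: "right_limit N x = N l" if x: "0 < x" "\<bar>x - l\<bar> < r" for x
  proof -
    have "\<forall>\<^sub>F y in at_right x. N l = N y"
      unfolding eventually_at_right_field
    proof (intro exI[of _ "l + r"] conjI allI impI)
      show "x < l + r" using x(2) by linarith
      show "N l = N y" if "x < y" "y < l + r" for y
        by (rule r(2)[symmetric]) (use that x(2) in linarith)
    qed
    then have "(N \<longlongrightarrow> N l) (at_right x)"
      by (rule Lim_transform_eventually[OF tendsto_const])
    then show ?thesis using x by (simp add: right_limit_def tendsto_Lim)
  qed
  have rl0: "right_limit N 0 = 0" by (simp add: right_limit_def)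
  show "emeasure (stieltjes N) {0<..l} = ennreal (N l)"
    using emeasure_stieltjes_Ioc[OF N, of 0 l] l(1) rl[of l] r(1) rl0 by simp
  show "0 \<le> N l"
    using right_limit_mono[OF N, of 0 l] rl[of l] r(1) l(1) rl0 by simp
  define a where "a = max (l / 2) (l - r / 2)"
  have a: "0 < a" "a < l" "\<bar>a - l\<bar> < r" using l(1) r(1) by (auto simp: a_def)
  have "{a<..l} \<in> null_sets (stieltjes N)"
    using emeasure_stieltjes_Ioc[OF N, of a l] a l(1) rl[of a] rl[of l] r(1)
    by (intro null_setsI) (auto simp: stieltjes_def)
  then show "AE x in stieltjes N. x \<noteq> l"
    by (rule AE_I') (use a in auto)
qed

lemma stieltjes_contour_estimate:
  fixes a :: "nat \<Rightarrow> complex" and c :: real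
  assumes q: "q > 1" and c: "0 < c"
    and pos: "\<And>x. x \<noteq> l \<Longrightarrow> c * (e / cmod (of_real x - Complex l e)) ^ Suc q \<le>
      Im (\<Sum>m=0..q - 2. a m * of_real (e ^ (q - 1 - m)) * kernel_integral q m l e x)"
    and N: "mono_on {0<..} N" "\<forall>\<^sub>F x in at_right 0. N x = 0"
      "(\<integral>\<^sup>+x\<in>{0<..}. ennreal (1 / x ^ q) \<partial>stieltjes N) < \<infinity>"
    and l: "0 < l" "0 < e" "\<forall>\<^sub>F x in nhds l. N x = N l"
    and \<Gamma>: "valid_path \<Gamma>" "path_image \<Gamma> \<inter> complex_of_real ` {0<..} = {}"
      "pathstart \<Gamma> = Complex l (- e)" "pathfinish \<Gamma> = Complex l e"
  defines "J \<equiv> \<lambda>m. contour_integral \<Gamma> (\<lambda>z. stieltjes_transform q N z * (of_real l - z) ^ m)"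
    and "\<kappa> \<equiv> (real q - 2) / real q"
  shows "cmod (of_real (N l) - 1 / (2 * of_real pi * \<i>) * (J (q - 1) + of_real (\<kappa> * e\<^sup>2) * J (q - 3)))
    \<le> (\<Sum>m=0..q - 2. cmod (a m) / c * e ^ (q - 1 - m) * cmod (J m))"
proof -
  obtain d where d: "0 < d"
    "integrable (restrict_space (stieltjes N) {d..}) (\<lambda>x. 1 / x ^ q)"
    "\<And>z. stieltjes_transform q N z = (\<integral>x. 1 / (of_real x - z) ^ q \<partial>restrict_space (stieltjes N) {d..})"
    "AE x in stieltjes N. d \<le> x"
    using stieltjes_restrict_space[OF N] by blast
  define M where "M = restrict_space (stieltjes N) {d..}"
  have S: "sets (stieltjes N) = sets borel" "space (stieltjes N) = UNIV"
    by (simp_all add: stieltjes_def)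
  note [measurable_cong] = S(1)
  have M: "sets M = sets (restrict_space borel {d..})"
    unfolding M_def by (rule sets_restrict_space_cong) (rule S)
  have Om: "{d..} \<inter> space (stieltjes N) \<in> sets (stieltjes N)" by (simp add: S)
  let ?k = "\<lambda>m x. kernel_integral q m l e x"
  have int: "integrable M (?k m)" and J: "J m = (\<integral>x. ?k m x \<partial>M)" if "m < q" for m
  proof -
    note R = contour_integral_kernel_transform[OF M d(1) d(2)[folded M_def] that \<Gamma>]
    show "integrable M (?k m)" by (rule R(1))
    show "J m = (\<integral>x. ?k m x \<partial>M)"
      unfolding J_def d(3) M_def[symmetric] by (rule contour_integral_unique[OF R(2)])
  qed
  note const = stieltjes_locally_constant[OF N(1,2) l(1,3)]
  have ne: "AE x in M. x \<noteq> l"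
    using const(3) unfolding M_def AE_restrict_space_iff[OF Om] by eventually_elim simp
  have "emeasure (stieltjes N) ({d..} \<inter> {..l}) = ennreal (N l)"
    unfolding const(1)[symmetric]
    by (rule emeasure_eq_AE) (use d(4) in \<open>auto simp: S elim!: eventually_mono, use d(1) in \<open>auto\<close>\<close>)
  then have em: "emeasure M ({d..} \<inter> {..l}) = ennreal (N l)"
    unfolding M_def by (subst emeasure_restrict_space[OF Om]) auto
  have space: "space M = {d..}" by (simp add: M_def space_restrict_space S)
  have meas: "{d..} \<inter> {..l} \<in> sets M"
    unfolding M_def by (auto simp: sets_restrict_space_iff[OF Om] S)
  have ind: "integrable M (\<lambda>x. complex_of_real (indicator {..l} x))"
    "(\<integral>x. complex_of_real (indicator {..l} x) \<partial>M) = of_real (N l)"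
  proof -
    have sp: "{d..} \<inter> {..l} \<inter> space M = {d..} \<inter> {..l}" by (auto simp: space)
    have "integrable M (indicator ({d..} \<inter> {..l}) :: real \<Rightarrow> real)"
      "(\<integral>x. indicator ({d..} \<inter> {..l}) x \<partial>M) = N l"
      using em meas const(2) sp by (simp_all add: measure_def)
    moreover have "(indicator ({d..} \<inter> {..l}) x :: real) = indicator {..l} x" if "x \<in> space M" for x
      using that by (auto simp: space indicator_def)
    ultimately have "integrable M (indicator {..l} :: real \<Rightarrow> real)"
      "(\<integral>x. indicator {..l} x \<partial>M) = N l"
      by (simp_all cong: Bochner_Integration.integrable_cong Bochner_Integration.integral_cong)
    then show "integrable M (\<lambda>x. complex_of_real (indicator {..l} x))"
      "(\<integral>x. complex_of_real (indicator {..l} x) \<partial>M) = of_real (N l)"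
      by simp_all
  qed
  define T where "T x = of_real (indicator {..l} x) - 1 / (2 * of_real pi * \<i>) *
      (?k (q - 1) x + of_real (\<kappa> * e\<^sup>2) * ?k (q - 3) x)" for x
  define A where "A x = (\<Sum>m=0..q - 2. a m * of_real (e ^ (q - 1 - m)) * ?k m x)" for x
  have lt: "q - 1 < q" "q - 3 < q" "\<And>m. m \<in> {0..q - 2} \<Longrightarrow> m < q" using q by auto
  have Tint: "integrable M T"
    unfolding T_def[abs_def]
    by (intro Bochner_Integration.integrable_diff Bochner_Integration.integrable_add integrable_mult_right ind int lt)
  have T: "(\<integral>x. T x \<partial>M) = of_real (N l) - 1 / (2 * of_real pi * \<i>) * (J (q - 1) + of_real (\<kappa> * e\<^sup>2) * J (q - 3))"
  proof -
    have k: "integrable M (\<lambda>x. ?k (q - 1) x + of_real (\<kappa> * e\<^sup>2) * ?k (q - 3) x)"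
      by (intro Bochner_Integration.integrable_add integrable_mult_right int lt)
    have "(\<integral>x. T x \<partial>M) = of_real (N l) - (\<integral>x. 1 / (2 * of_real pi * \<i>) *
        (?k (q - 1) x + of_real (\<kappa> * e\<^sup>2) * ?k (q - 3) x) \<partial>M)"
      unfolding T_def ind(2)[symmetric]
      by (rule Bochner_Integration.integral_diff[OF ind(1) integrable_mult_right[OF k]])
    also have "(\<integral>x. 1 / (2 * of_real pi * \<i>) * (?k (q - 1) x + of_real (\<kappa> * e\<^sup>2) * ?k (q - 3) x) \<partial>M)
        = 1 / (2 * of_real pi * \<i>) * (\<integral>x. ?k (q - 1) x + of_real (\<kappa> * e\<^sup>2) * ?k (q - 3) x \<partial>M)"
      by (rule integral_mult_right_zero)
    also have "(\<integral>x. ?k (q - 1) x + of_real (\<kappa> * e\<^sup>2) * ?k (q - 3) x \<partial>M) = J (q - 1) + of_real (\<kappa> * e\<^sup>2) * J (q - 3)"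
      unfolding J[OF lt(1)] J[OF lt(2)]
      by (subst Bochner_Integration.integral_add[OF int[OF lt(1)] integrable_mult_right[OF int[OF lt(2)]]])
        (simp only: integral_mult_right_zero)
    finally show ?thesis .
  qed
  have Aint: "integrable M A"
    unfolding A_def[abs_def] by (intro Bochner_Integration.integrable_sum integrable_mult_right int lt)
  have A: "(\<integral>x. A x \<partial>M) = (\<Sum>m=0..q - 2. a m * of_real (e ^ (q - 1 - m)) * J m)"
  proof -
    have "(\<integral>x. A x \<partial>M) = (\<Sum>m=0..q - 2. \<integral>x. a m * of_real (e ^ (q - 1 - m)) * ?k m x \<partial>M)"
      unfolding A_def by (intro Bochner_Integration.integral_sum integrable_mult_right int lt)
    also have "\<dots> = (\<Sum>m=0..q - 2. a m * of_real (e ^ (q - 1 - m)) * J m)"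
      by (intro sum.cong refl) (simp only: integral_mult_right_zero J[OF lt(3)])
    finally show ?thesis .
  qed
  have "AE x in M. norm (T x) \<le> Im (A x) / c"
    using ne
  proof eventually_elim
    case (elim x)
    have "norm (T x) \<le> (e / cmod (of_real x - Complex l e)) ^ Suc q"
      unfolding T_def \<kappa>_def by (rule indicator_kernel_bound[OF q l(2) elim])
    also have "\<dots> \<le> Im (A x) / c"
      using pos[OF elim] c unfolding A_def by (simp only: pos_le_divide_eq mult.commute)
    finally show ?case .
  qed
  then have "(\<integral>x. norm (T x) \<partial>M) \<le> (\<integral>x. Im (A x) / c \<partial>M)"
    using Tint Aint by (intro integral_mono_AE) auto
  also have "\<dots> = Im (\<integral>x. A x \<partial>M) / c"
    using Aint by simp
  also have "\<dots> \<le> cmod (\<integral>x. A x \<partial>M) / c"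
    using c abs_Im_le_cmod[of "\<integral>x. A x \<partial>M"] by (intro divide_right_mono) auto
  also have "\<dots> \<le> (\<Sum>m=0..q - 2. cmod (a m * of_real (e ^ (q - 1 - m)) * J m)) / c"
    unfolding A using c by (intro divide_right_mono norm_sum) auto
  also have "\<dots> = (\<Sum>m=0..q - 2. cmod (a m) / c * e ^ (q - 1 - m) * cmod (J m))"
    unfolding sum_divide_distrib using l(2) by (intro sum.cong refl) (simp add: norm_mult norm_power)
  finally have "(\<integral>x. norm (T x) \<partial>M) \<le> (\<Sum>m=0..q - 2. cmod (a m) / c * e ^ (q - 1 - m) * cmod (J m))" .
  with integral_norm_bound[of M T] show ?thesis unfolding T by linarith
qed

theorem theorem2:
  fixes q :: nat
  assumes "q > 1"
  shows "\<exists>C :: nat \<Rightarrow> real.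
    \<forall>(N :: real \<Rightarrow> real) (x\<^sub>0 :: real) (\<eta>\<^sub>0 :: real) (\<Gamma> :: real \<Rightarrow> complex).
      mono_on {0<..} N \<longrightarrow>
      (\<forall>\<^sub>F x in at_right 0. N x = 0) \<longrightarrow>
      (\<integral>\<^sup>+x\<in>{0<..}. ennreal (1 / x ^ q) \<partial>stieltjes N) < \<infinity> \<longrightarrow>
      x\<^sub>0 > 0 \<longrightarrow> \<eta>\<^sub>0 > 0 \<longrightarrow>
      (\<forall>\<^sub>F x in nhds x\<^sub>0. N x = N x\<^sub>0) \<longrightarrow>
      valid_path \<Gamma> \<longrightarrow>
      pathstart \<Gamma> = Complex x\<^sub>0 (- \<eta>\<^sub>0) \<longrightarrow>
      pathfinish \<Gamma> = Complex x\<^sub>0 \<eta>\<^sub>0 \<longrightarrow>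
      path_image \<Gamma> \<inter> complex_of_real ` {0<..} = {} \<longrightarrow>
      cmod (of_real (N x\<^sub>0) - 1 / (2 * of_real pi * \<i>) *
              contour_integral \<Gamma> (\<lambda>\<zeta>. stieltjes_transform q N \<zeta> * (of_real x\<^sub>0 - \<zeta>) ^ (q - 1)))
        \<le> (\<Sum>m = 0..q - 2. C m * \<eta>\<^sub>0 ^ (q - 1 - m) *
              cmod (contour_integral \<Gamma>
                (\<lambda>\<zeta>. stieltjes_transform q N \<zeta> * (of_real x\<^sub>0 - \<zeta>) ^ m)))"
proof -
  obtain a :: "nat \<Rightarrow> complex" and c where c: "0 < c"
    and pos: "\<And>x l e. 0 < e \<Longrightarrow> x \<noteq> l \<Longrightarrow> c * (e / cmod (of_real x - Complex l e)) ^ Suc q \<le>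
      Im (\<Sum>m=0..q - 2. a m * of_real (e ^ (q - 1 - m)) * kernel_integral q m l e x)"
    using kernel_integral_positive_combination[OF assms] by blast
  define \<kappa> where "\<kappa> = (real q - 2) / real q"
  have \<kappa>: "0 \<le> \<kappa>" "q = 2 \<Longrightarrow> \<kappa> = 0" using assms by (auto simp: \<kappa>_def)
  define C where "C m = cmod (a m) / c + (if m = q - 3 then \<kappa> / (2 * pi) else 0)" for m
  show ?thesis
  proof (intro exI[of _ C] allI impI)
    fix N :: "real \<Rightarrow> real" and l e :: real and \<Gamma> :: "real \<Rightarrow> complex"
    assume H: "mono_on {0<..} N" "\<forall>\<^sub>F x in at_right 0. N x = 0"
      "(\<integral>\<^sup>+x\<in>{0<..}. ennreal (1 / x ^ q) \<partial>stieltjes N) < \<infinity>" "0 < l" "0 < e"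
      "\<forall>\<^sub>F x in nhds l. N x = N l"
      "valid_path \<Gamma>" "pathstart \<Gamma> = Complex l (- e)" "pathfinish \<Gamma> = Complex l e"
      "path_image \<Gamma> \<inter> complex_of_real ` {0<..} = {}"
    define J where "J m = contour_integral \<Gamma> (\<lambda>z. stieltjes_transform q N z * (of_real l - z) ^ m)" for m
    have main: "cmod (of_real (N l) - 1 / (2 * of_real pi * \<i>) * (J (q - 1) + of_real (\<kappa> * e\<^sup>2) * J (q - 3)))
        \<le> (\<Sum>m=0..q - 2. cmod (a m) / c * e ^ (q - 1 - m) * cmod (J m))"
      unfolding J_def \<kappa>_def
      by (rule stieltjes_contour_estimate[OF assms c pos[OF H(5)] H(1-6) H(7,10,8,9)])
    have "cmod (of_real (N l) - 1 / (2 * of_real pi * \<i>) * J (q - 1))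
        \<le> cmod (of_real (N l) - 1 / (2 * of_real pi * \<i>) * (J (q - 1) + of_real (\<kappa> * e\<^sup>2) * J (q - 3)))
          + cmod (1 / (2 * of_real pi * \<i>) * (of_real (\<kappa> * e\<^sup>2) * J (q - 3)))"
    proof -
      have "u - v * w = (u - v * (w + t)) + v * t" for u v w t :: complex
        by (simp add: algebra_simps)
      then show ?thesis by (metis norm_triangle_ineq)
    qed
    also have "cmod (1 / (2 * of_real pi * \<i>) * (of_real (\<kappa> * e\<^sup>2) * J (q - 3)))
        = \<kappa> / (2 * pi) * e\<^sup>2 * cmod (J (q - 3))"
      using \<kappa>(1) by (simp add: norm_mult norm_divide norm_power)
    also have "\<dots> = (\<Sum>m=0..q - 2. (if m = q - 3 then \<kappa> / (2 * pi) else 0) * e ^ (q - 1 - m) * cmod (J m))"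
    proof -
      have "(\<Sum>m=0..q - 2. (if m = q - 3 then \<kappa> / (2 * pi) else 0) * e ^ (q - 1 - m) * cmod (J m))
        = (\<Sum>m=0..q - 2. if m = q - 3 then \<kappa> / (2 * pi) * e ^ (q - 1 - m) * cmod (J m) else 0)"
        by (intro sum.cong refl) simp
      also have "\<dots> = \<kappa> / (2 * pi) * e ^ (q - 1 - (q - 3)) * cmod (J (q - 3))"
        by simp
      also have "\<kappa> / (2 * pi) * e ^ (q - 1 - (q - 3)) = \<kappa> / (2 * pi) * e\<^sup>2"
      proof (cases "q = 2")
        case False
        with assms have "q - 1 - (q - 3) = 2" by simp
        then show ?thesis by simp
      qed (simp add: \<kappa>)
      finally show ?thesis ..
    qed
    also note main
    also have "(\<Sum>m=0..q - 2. cmod (a m) / c * e ^ (q - 1 - m) * cmod (J m)) +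
        (\<Sum>m=0..q - 2. (if m = q - 3 then \<kappa> / (2 * pi) else 0) * e ^ (q - 1 - m) * cmod (J m))
      = (\<Sum>m=0..q - 2. C m * e ^ (q - 1 - m) * cmod (J m))"
      unfolding sum.distrib[symmetric] C_def distrib_right ..
    finally show "cmod (of_real (N l) - 1 / (2 * of_real pi * \<i>) *
          contour_integral \<Gamma> (\<lambda>z. stieltjes_transform q N z * (of_real l - z) ^ (q - 1)))
        \<le> (\<Sum>m=0..q - 2. C m * e ^ (q - 1 - m) *
              cmod (contour_integral \<Gamma> (\<lambda>z. stieltjes_transform q N z * (of_real l - z) ^ m)))"
      by (simp add: J_def)
  qed
qed

end
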